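(* Let $k>\ell\ge1$ be integers, $\lambda\in[0,k+\ell-5]$, $m\ge\max\{7,k+\ell-1,5T(\frac1{k+\ell})\}$, and let $p=(k+\ell)m+2+\lambda$ be prime; let $n\ge2$. Let $A\subset\mathbb F_p^n$ be a nontrivial $(k,\ell)$-sum-free set with $|A|\ge mp^{n-1}$. If there exists a decomposition $(v,K)$ of $\mathbb F_p^n$ with $\omega\le m+1$, then $A$ is normal up to isomorphism.
   Context: $hX=\{x_1+\dots+x_h:x_i\in X\}$; $A$ is $(k,\ell)$-sum-free if $A\ne\emptyset$ and $kA\cap\ell A=\emptyset$. Subsets of $\mathbb F_p^n$ are isomorphic if an automorphism of the additive group maps one onto the other. $[a,b]=\{a,\dots,b\}\subseteq\mathbb F_p$ (cyclic). A decomposition $(v,K)$: $K$ a subspace of dimension $n-1$, $v\notin K$; $\omega$ = number of $i\in\mathbb F_p$ with $(A-iv)\cap K\ne\emptyset$. Extremal cuboids: $A_{k,\ell,p,j}=[a_j,a_j+m]\times\mathbb F_p^{n-1}$, $a_j=-(km+1+j)(k-\ell)^{-1}$, $j\in[0,\lceil\frac{\lambda+1}2\rceil-1]$; trivial = isomorphic to a subset of some extremal cuboid; nontrivial otherwise. Normal means type 1 or type 2, where for $|A|=mp^{n-1}$: type 1: $A$ isomorphic to $[a,a+m-1]\times\mathbb F_p^{n-1}$ with $\ell a-k(a+m-1)\in[1,\ell]$ or $\in[\lambda+\ell+2,k]$ (latter only if $\lambda+\ell+2\le k$); type 2: $\ell=1$, $n\ge2$, $A$ isomorphic to $(\{a\}\times(\mathbb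 F_p^{n-1}\setminus V))\sqcup([a+1,a+m-1]\times\mathbb F_p^{n-1})\sqcup(\{a+m\}\times V)$ with $a=mk(\ell-k)^{-1}$ and $V$ a proper subspace. The function $T$: a finite $X\subseteq\mathbb F_p$ has the covering property if it lies in an arithmetic progression of length $|X+X|-|X|+1$; for $c\in(0,1)$, $\tau\in(0,1]$ is feasible for $c$ if (for every prime $p$) every $X\subseteq\mathbb F_p$ with $|X|\le cp$ and $|X+X|\le(2+\tau)|X|-3$ has the covering property; $T(c)=1/\tau(c)$ with $\tau(c)$ the supremum of feasible $\tau$. *)

theory Defs
  imports
    "HOL-Analysis.Cartesian_Space"
    "HOL-Library.Extended_Nonnegative_Real"
    "Berlekamp_Zassenhaus.Finite_Field"
begin

text \<open>
  The prime field with \<open>p = CARD('p)\<close> elements is \<open>'p mod_ring\<close> with \<open>'p :: prime_card\<close>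
  (the class says that \<open>CARD('p)\<close> is prime), and its \<open>n\<close>-th power is \<open>'p mod_ring ^ 'n\<close>
  with \<open>n = CARD('n)\<close>.
\<close>

definition hfold_sum :: "nat \<Rightarrow> 'a::comm_monoid_add set \<Rightarrow> 'a set" where
  "hfold_sum h X = {(\<Sum>i<h. x i) | x. \<forall>i<h. x i \<in> X}"

definition sum_free :: "nat \<Rightarrow> nat \<Rightarrow> 'a::comm_monoid_add set \<Rightarrow> bool" where
  "sum_free k l A \<longleftrightarrow> A \<noteq> {} \<and> hfold_sum k A \<inter> hfold_sum l A = {}"

definition isomorphic_sets :: "'a::ab_group_add set \<Rightarrow> 'a set \<Rightarrow> bool" where
  "isomorphic_sets A B \<longleftrightarrow> (\<exists>f. bij f \<and> Modules.additive f \<and> f ` A = B)"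

text \<open>
  Cyclic intervals: start at \<open>a\<close> and add 1 until \<open>b\<close> is reached for the first time;
  \<open>to_int_mod_ring\<close> is the representative in \<open>{0..<p}\<close>.
\<close>

definition cyc_interval :: "'p::prime_card mod_ring \<Rightarrow> 'p mod_ring \<Rightarrow> 'p mod_ring set" where
  "cyc_interval a b = {a + of_int i | i. 0 \<le> i \<and> i \<le> to_int_mod_ring (b - a)}"

definition decomposition ::
    "('p::prime_card mod_ring ^ 'n::finite) \<Rightarrow> ('p mod_ring ^ 'n) set \<Rightarrow> bool" where
  "decomposition v K \<longleftrightarrow> vec.subspace K \<and> vec.dim K = CARD('n) - 1 \<and> v \<notin> K"

definition omega ::
    "('p::prime_card mod_ring ^ 'n::finite) set \<Rightarrow> ('p mod_ring ^ 'n) \<Rightarrow> ('p mod_ring ^ 'n) set \<Rightarrow> nat"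
  where
  "omega A v K = card {i :: 'p mod_ring. (\<lambda>x. x - i *s v) ` A \<inter> K \<noteq> {}}"

text \<open>
  The splitting of the \<open>n\<close>-th power of the field into first coordinate and the remaining ones is
  expressed with an arbitrary index \<open>c\<close> for the first coordinate.  The other factor is
  identified with \<open>coord_hyperplane c\<close>; for \<open>W\<close> contained in it, \<open>coord_prod c S W\<close> is
  the product of \<open>S\<close> and \<open>W\<close>.
\<close>

definition coord_hyperplane :: "'n::finite \<Rightarrow> ('p::prime_card mod_ring ^ 'n) set" where
  "coord_hyperplane c = {x. x $ c = 0}"

definition coord_prod ::
    "'n::finite \<Rightarrow> 'p::prime_card mod_ring set \<Rightarrow> ('p mod_ring ^ 'n) set \<Rightarrow> ('p mod_ring ^ 'n) set"
  where
  "coord_prod c S W = {axis c s + w | s w. s \<in> S \<and> w \<in> W}"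

definition extremal_cuboid ::
    "'n::finite \<Rightarrow> nat \<Rightarrow> nat \<Rightarrow> nat \<Rightarrow> nat \<Rightarrow> ('p::prime_card mod_ring ^ 'n) set" where
  "extremal_cuboid c k l m j =
     (let a = - of_nat (k * m + 1 + j) * inverse (of_nat k - of_nat l)
      in coord_prod c (cyc_interval a (a + of_nat m)) (coord_hyperplane c))"

text \<open>Here and below \<open>r\<close> is the parameter \<open>\<lambda>\<close>.\<close>

definition trivial_set ::
    "'n::finite \<Rightarrow> nat \<Rightarrow> nat \<Rightarrow> nat \<Rightarrow> nat \<Rightarrow> ('p::prime_card mod_ring ^ 'n) set \<Rightarrow> bool" where
  "trivial_set c k l m r A \<longleftrightarrow>
     (\<exists>j B. int j \<le> \<lceil>(real r + 1) / 2\<rceil> - 1 \<and> B \<subseteq> extremal_cuboid c k l m j \<and> isomorphic_sets A B)"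

definition type1 ::
    "'n::finite \<Rightarrow> nat \<Rightarrow> nat \<Rightarrow> nat \<Rightarrow> nat \<Rightarrow> ('p::prime_card mod_ring ^ 'n) set \<Rightarrow> bool" where
  "type1 c k l m r A \<longleftrightarrow>
     (\<exists>a. isomorphic_sets A
            (coord_prod c (cyc_interval a (a + of_nat m - 1)) (coord_hyperplane c)) \<and>
          (of_nat l * a - of_nat k * (a + of_nat m - 1) \<in> cyc_interval 1 (of_nat l) \<or>
           (r + l + 2 \<le> k \<and>
            of_nat l * a - of_nat k * (a + of_nat m - 1)
              \<in> cyc_interval (of_nat (r + l + 2)) (of_nat k))))"

definition type2 ::
    "'n::finite \<Rightarrow> nat \<Rightarrow> nat \<Rightarrow> nat \<Rightarrow> ('p::prime_card mod_ring ^ 'n) set \<Rightarrow> bool" where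
  "type2 c k l m A \<longleftrightarrow>
     l = 1 \<and> CARD('n) \<ge> 2 \<and>
     (\<exists>V. vec.subspace V \<and> V \<subset> coord_hyperplane c \<and>
        (let a = of_nat (m * k) * inverse (of_nat l - of_nat k)
         in isomorphic_sets A
              (coord_prod c {a} (coord_hyperplane c - V) \<union>
               coord_prod c (cyc_interval (a + 1) (a + of_nat m - 1)) (coord_hyperplane c) \<union>
               coord_prod c {a + of_nat m} V)))"

definition normal_set ::
    "'n::finite \<Rightarrow> nat \<Rightarrow> nat \<Rightarrow> nat \<Rightarrow> nat \<Rightarrow> ('p::prime_card mod_ring ^ 'n) set \<Rightarrow> bool" where
  "normal_set c k l m r A \<longleftrightarrow>
     card A = m * CARD('p) ^ (CARD('n) - 1) \<and> (type1 c k l m r A \<or> type2 c k l m A)"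

text \<open>
  Feasibility quantifies over all primes inside the formula, so the prime fields occurring in it are
  represented by \<open>{0..<q}\<close> with arithmetic modulo \<open>q\<close>.
\<close>

definition sumset_mod :: "nat \<Rightarrow> nat set \<Rightarrow> nat set" where
  "sumset_mod q X = {(x + y) mod q | x y. x \<in> X \<and> y \<in> X}"

definition covering_property :: "nat \<Rightarrow> nat set \<Rightarrow> bool" where
  "covering_property q X \<longleftrightarrow>
     (\<exists>a d. X \<subseteq> {(a + i * d) mod q | i. i < card (sumset_mod q X) - card X + 1})"

definition feasible :: "real \<Rightarrow> real \<Rightarrow> bool" where
  "feasible c t \<longleftrightarrow>
     0 < t \<and> t \<le> 1 \<and>
     (\<forall>q X. prime q \<longrightarrow> X \<subseteq> {0..<q} \<longrightarrow> real (card X) \<le> c * real q \<longrightarrow>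
        real (card (sumset_mod q X)) \<le> (2 + t) * real (card X) - 3 \<longrightarrow> covering_property q X)"

text \<open>
  Values in \<open>ennreal\<close>: the supremum of the empty set is 0, so that \<open>Tfun c = \<infinity>\<close> if no
  \<open>t\<close> is feasible for \<open>c\<close> (instead of an unspecified real number).
\<close>

definition Tfun :: "real \<Rightarrow> ennreal" where
  "Tfun c = 1 / (SUP t\<in>{t. feasible c t}. ennreal t)"

end

theory Submission
  imports Defs "HOL-Library.Set_Algebras"
begin

text \<open>
  After an automorphism the decomposition is the one given by the coordinate \<open>c\<close>, so let \<open>S\<close> be
  the set of values of this coordinate on \<open>A\<close> and \<open>N = p ^ (n - 1)\<close>. As \<open>|A| \<ge> m N\<close>, the set
  \<open>S\<close> has \<open>m\<close> or \<open>m + 1\<close> elements.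

  If \<open>|S| = m\<close>, then all fibres are full and \<open>S\<close> is \<open>(k, l)\<close>-sum-free. Unless \<open>S\<close> lies in a
  progression of length \<open>m + 1\<close>, one has \<open>|h S| \<ge> h (m + 1) - 1\<close> for \<open>h = k, l\<close>, so that
  \<open>|k S| + |l S| > p\<close>. For \<open>|S + S| \<le> 2 m + 1\<close> this bound comes from the covering property: \<open>S\<close>
  lies in a progression of length \<open>m + 2\<close>, where \<open>h S\<close> can be counted over the integers. For
  larger \<open>S + S\<close> it comes from Vosper's theorem applied to the multiples of \<open>S + S\<close>. A
  progression of length \<open>m + 1\<close> with one hole can only be trivial or, if the hole is at an end, of
  type 1.

  If \<open>|S| = m + 1\<close>, then any two fibres have at least \<open>N\<close> elements together, while a solution of
  \<open>x\<^sub>1 + \<dots> + x\<^sub>k = y\<^sub>1 + \<dots> + y\<^sub>l\<close> in \<open>S\<close> forces any two fibres used in it to have at most \<open>N\<close>.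
  Hence \<open>k S\<close> and \<open>l S\<close> have at most one common element, \<open>S\<close> is a progression by Vosper's theorem,
  and \<open>A\<close> is trivial unless the intervals \<open>k S\<close> and \<open>l S\<close> meet in an endpoint. In that case \<open>l = 1\<close>,
  the fibre over one end of \<open>S\<close> is a coset of a subspace, and the fibre over the other end is the
  complement of a coset.
\<close>

section \<open>Sumsets in the prime field\<close>

text \<open>Degenerate progressions are allowed: with \<open>d = 0\<close>, or with \<open>n\<close>
  above the additive order of \<open>d\<close>, the set has fewer than \<open>n\<close>
  elements.\<close>

definition ap :: "'a::comm_semiring_1 \<Rightarrow> 'a \<Rightarrow> nat \<Rightarrow> 'a set" where
  "ap a d n = (\<lambda>i. a + of_nat i * d) ` {..<n}"

lemma of_nat_mod_ring_eq_iff: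
  assumes "i < CARD('p::prime_card)" "j < CARD('p)"
  shows "(of_nat i :: 'p mod_ring) = of_nat j \<longleftrightarrow> i = j"
  using assms by (simp add: of_nat_eq_iff_cong_CHAR cong_def)

lemma of_nat_mod_ring_eq_0_iff: "(of_nat n :: 'p::prime_card mod_ring) = 0 \<longleftrightarrow> CARD('p) dvd n"
  by (simp add: of_nat_eq_0_iff_char_dvd)

lemma card_ap:
  fixes d :: "'p::prime_card mod_ring"
  assumes "d \<noteq> 0" "n \<le> CARD('p)"
  shows "card (ap a d n) = n"
proof -
  have "inj_on (\<lambda>i. a + of_nat i * d) {..<n}"
  proof (rule inj_onI)
    fix i j assume "i \<in> {..<n}" "j \<in> {..<n}" and "a + of_nat i * d = a + of_nat j * d"
    then have "i < CARD('p)" "j < CARD('p)" "(of_nat i :: 'p mod_ring) = of_nat j"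
      using assms by auto
    then show "i = j"
      using of_nat_mod_ring_eq_iff by blast
  qed
  then show ?thesis
    by (simp add: ap_def card_image)
qed

text \<open>The multiples of \<open>d\<close> run through the whole prime field.\<close>

lemma translation_closed_eq_UNIV:
  fixes X :: "'p::prime_card mod_ring set"
  assumes "X \<noteq> {}" "d \<noteq> 0" and closed: "\<And>x. x \<in> X \<Longrightarrow> x + d \<in> X"
  shows "X = UNIV"
proof -
  obtain x where x: "x \<in> X"
    using assms by blast
  have *: "x + of_nat i * d \<in> X" for i
  proof (induction i)
    case (Suc i)
    then show ?case
      using closed[OF Suc] by (simp add: algebra_simps)
  qed (use x in simp)
  have "y \<in> X" for y
  proof -
    obtain i where "(y - x) / d = of_nat i"
      using surj_of_nat_mod_ring by metis
    then have "y = x + of_nat i * d"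
      using \<open>d \<noteq> 0\<close> by (simp add: field_simps)
    then show ?thesis
      using * by simp
  qed
  then show ?thesis
    by blast
qed

section \<open>The Cauchy-Davenport theorem\<close>

lemma set_plus_memI: "a \<in> A \<Longrightarrow> b \<in> B \<Longrightarrow> x = a + b \<Longrightarrow> x \<in> A + B"
  by (auto simp: set_plus_def)

lemma card_translate_set: "card ((+) (a::'a::ab_group_add) ` X) = card X"
  by (simp add: card_image)

lemma translate_set_plus:
  fixes a b :: "'a::ab_group_add"
  shows "(+) a ` X + (+) b ` Y = (+) (a + b) ` (X + Y)"
proof -
  have eq: "a + u + (b + v) = a + b + (u + v)" for u v
    by (simp add: algebra_simps)
  show ?thesis
    by (auto simp: set_plus_def eq)
qed

text \<open>Dyson's transform: the part of \<open>e + B\<close> outside \<open>A\<close> is moved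
  over to \<open>A\<close>. A new sum \<open>(e + b') + b\<close> regroups as
  \<open>(e + b) + b'\<close>, and since \<open>e + B'\<close> is \<open>A \<inter> (e + B)\<close>,
  inclusion-exclusion preserves the total size.\<close>

lemma e_transform:
  fixes A B :: "'a::{ab_group_add,finite} set"
  assumes "e \<in> A" "0 \<in> B"
  defines "A' \<equiv> A \<union> (+) e ` B" and "B' \<equiv> {b \<in> B. e + b \<in> A}"
  shows "A' + B' \<subseteq> A + B" "card A' + card B' = card A + card B" "0 \<in> B'" "A \<subseteq> A'" "B' \<subseteq> B"
proof -
  show "A' + B' \<subseteq> A + B"
  proof
    fix z assume "z \<in> A' + B'"
    then obtain x b where x: "x \<in> A'" and b: "b \<in> B" "e + b \<in> A" and z: "z = x + b"
      by (auto simp: set_plus_def B'_def)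
    show "z \<in> A + B"
    proof (cases "x \<in> A")
      case True
      then show ?thesis
        using b z by (auto simp: set_plus_def)
    next
      case False
      then obtain b' where "b' \<in> B" "x = e + b'"
        using x by (auto simp: A'_def)
      then show ?thesis
        using b z by (intro set_plus_memI[of "e + b" A b' B]) (auto simp: algebra_simps)
    qed
  qed
  have "(+) e ` B' = A \<inter> (+) e ` B"
    by (auto simp: B'_def)
  then have "card B' = card (A \<inter> (+) e ` B)"
    by (metis card_translate_set)
  then show "card A' + card B' = card A + card B"
    unfolding A'_def by (metis card_Un_Int card_translate_set finite)
qed (use assms in auto)

lemma subset_set_plus_zero: "0 \<in> B \<Longrightarrow> (A :: 'a::comm_monoid_add set) \<subseteq> A + B"
  by (auto simp: set_plus_def intro!: bexI)

text \<open>Provides a transform that strictly shrinks \<open>B\<close>: if every translate stayed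
  inside \<open>A\<close>, then \<open>A\<close> would be closed under adding
  \<open>b\<close>.\<close>

lemma exists_not_translate_subset:
  fixes A B :: "'p::prime_card mod_ring set"
  assumes "A \<noteq> {}" "A \<noteq> UNIV" "b \<in> B" "b \<noteq> 0"
  shows "\<exists>e\<in>A. \<not> (+) e ` B \<subseteq> A"
proof (rule ccontr)
  assume "\<not> ?thesis"
  then have "\<And>x. x \<in> A \<Longrightarrow> x + b \<in> A"
    using assms by auto
  then show False
    using translation_closed_eq_UNIV[of A b] assms by blast
qed

lemma ex_nonzero_mem: "2 \<le> card B \<Longrightarrow> \<exists>b\<in>B. b \<noteq> (0::'a::zero)"
  using card_mono[of "{0}" B] by auto

text \<open>Induction on \<open>card B\<close>. After a translation putting 0 into \<open>B\<close>,
  some e-transform strictly shrinks \<open>B\<close>, keeps the total size and does not enlarge the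
  sumset; this stops when \<open>A\<close> is everything or \<open>B\<close> is a point.\<close>

theorem cauchy_davenport:
  fixes A B :: "'p::prime_card mod_ring set"
  assumes "A \<noteq> {}" "B \<noteq> {}"
  shows "min CARD('p) (card A + card B - 1) \<le> card (A + B)"
  using assms
proof (induction "card B" arbitrary: A B rule: less_induct)
  case less
  obtain b0 where b0: "b0 \<in> B"
    using less.prems by blast
  define C where "C = (+) (-b0) ` B"
  have C: "0 \<in> C" "card C = card B" "card (A + C) = card (A + B)"
    using b0 translate_set_plus[of 0 A "-b0" B]
    by (auto simp: C_def card_translate_set simp del: add_uminus_conv_diff uminus_add_conv_diff
        intro!: image_eqI[of _ _ b0])
  have sub: "A \<subseteq> A + C"
    using C subset_set_plus_zero by blast
  consider "A = UNIV" | "card C \<le> 1" | "A \<noteq> UNIV" "2 \<le> card C"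
    by linarith
  then show ?case
  proof cases
    case 1
    then have "A + C = UNIV"
      using sub by blast
    then show ?thesis
      using C(3) by (metis CARD_mod_ring min.cobounded1)
  next
    case 2
    then show ?thesis
      using C card_mono[OF _ sub] by simp
  next
    case 3
    obtain b where "b \<in> C" "b \<noteq> 0"
      using 3 ex_nonzero_mem by blast
    then obtain e where e: "e \<in> A" "\<not> (+) e ` C \<subseteq> A"
      using exists_not_translate_subset less.prems 3 by metis
    let ?A = "A \<union> (+) e ` C" and ?C = "{b \<in> C. e + b \<in> A}"
    note tr = e_transform[OF e(1) C(1)]
    have "?C \<subset> C"
      using e by auto
    then have "card ?C < card B"
      using C(2) psubset_card_mono[of C ?C] by simp
    moreover have "?A \<noteq> {}" "?C \<noteq> {}"
      using tr(3) e by auto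
    ultimately have "min CARD('p) (card ?A + card ?C - 1) \<le> card (?A + ?C)"
      using less.hyps by blast
    then show ?thesis
      using tr(2) card_mono[OF _ tr(1)] C by simp
  qed
qed

section \<open>Arithmetic progressions and Vosper's theorem\<close>

lemma reverse_ap:
  fixes a d :: "'a::comm_ring_1"
  shows "ap a d n = ap (a + (of_nat n - 1) * d) (- d) n"
proof -
  have *: "a + of_nat i * d \<in> ap (a + (of_nat n - 1) * d) (- d) n" if "i < n" for i and a d :: 'a
  proof -
    have "a + of_nat i * d = a + (of_nat n - 1) * d + of_nat (n - 1 - i) * (-d)"
      using that by (simp add: of_nat_diff algebra_simps)
    then show ?thesis
      unfolding ap_def using that by (intro image_eqI[of _ _ "n - 1 - i"]) auto
  qed
  have 1: "ap a d n \<subseteq> ap (a + (of_nat n - 1) * d) (- d) n" for a d :: 'a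
    using * unfolding ap_def[of a d n] by blast
  show ?thesis
    using 1[of a d] 1[of "a + (of_nat n - 1) * d" "-d"] by (simp add: algebra_simps)
qed

text \<open>Walk back from \<open>y\<close> in steps of \<open>d\<close> as long as the points lie
  in \<open>A\<close>. This run \<open>Q\<close> absorbs the only exit, so what is left of
  \<open>A\<close> is closed under adding \<open>d\<close> and must be empty.\<close>

lemma ap_of_one_exit:
  fixes A :: "'p::prime_card mod_ring set"
  assumes d: "d \<noteq> 0" and "A \<noteq> {}" and y: "y \<notin> A"
    and exit: "\<And>x. x \<in> A \<Longrightarrow> x + d \<notin> A \<Longrightarrow> x + d = y"
  shows "\<exists>a. A = ap a d (card A)"
proof -
  \<comment> \<open>\<open>j\<close> counts the backward steps to the first point outside
    \<open>A\<close>; it is at most \<open>p\<close>, because \<open>p\<close> steps lead back to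
    \<open>y\<close>.\<close>
  define j where "j = (LEAST j. 0 < j \<and> y - of_nat j * d \<notin> A)"
  have ex: "\<exists>j. 0 < j \<and> y - of_nat j * d \<notin> A"
    using y by (intro exI[of _ "CARD('p)"]) auto
  have j: "0 < j" "y - of_nat j * d \<notin> A"
    using LeastI_ex[OF ex] by (auto simp: j_def)
  have jle: "j \<le> CARD('p)"
    unfolding j_def by (rule Least_le) (use y in auto)
  have jmin: "y - of_nat i * d \<in> A" if "0 < i" "i < j" for i
    using not_less_Least[of i "\<lambda>j. 0 < j \<and> y - of_nat j * d \<notin> A"] that unfolding j_def by blast
  define Q where "Q = ap (y - d) (-d) (j - 1)"
  have Qmem: "x \<in> Q \<longleftrightarrow> (\<exists>i. 0 < i \<and> i < j \<and> x = y - of_nat i * d)" for x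
  proof
    assume "x \<in> Q"
    then obtain i where "i < j - 1" "x = y - d + of_nat i * (-d)"
      by (auto simp: Q_def ap_def)
    then show "\<exists>i. 0 < i \<and> i < j \<and> x = y - of_nat i * d"
      by (intro exI[of _ "Suc i"]) (auto simp: algebra_simps)
  next
    assume "\<exists>i. 0 < i \<and> i < j \<and> x = y - of_nat i * d"
    then obtain i where i: "0 < i" "i < j" "x = y - of_nat i * d"
      by blast
    then show "x \<in> Q"
      unfolding Q_def ap_def by (intro image_eqI[of _ _ "i - 1"]) (auto simp: algebra_simps of_nat_diff)
  qed
  have "Q \<subseteq> A"
    using jmin Qmem by auto
  have closed: "x + d \<in> A - Q" if "x \<in> A - Q" for x
  proof -
    have xA: "x \<in> A" "x \<notin> Q"
      using that by auto
    have ne: "x \<noteq> y - of_nat i * d" if "0 < i" "i \<le> j" for i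
      using that xA j(2) Qmem[of x] by (metis le_neq_implies_less)
    have "x + d \<in> A"
    proof (rule ccontr)
      assume "x + d \<notin> A"
      then have "x = y - of_nat 1 * d"
        using exit[OF xA(1)] by (auto simp: algebra_simps)
      then show False
        using ne[of 1] j(1) by simp
    qed
    moreover have "x + d \<notin> Q"
    proof
      assume "x + d \<in> Q"
      then obtain i where i: "i < j" "x + d = y - of_nat i * d"
        using Qmem by blast
      then have "x = y - of_nat (Suc i) * d"
        by (simp add: algebra_simps)
      then show False
        using ne[of "Suc i"] i by simp
    qed
    ultimately show ?thesis
      by blast
  qed
  have "A - Q = {}"
    using translation_closed_eq_UNIV[OF _ d closed] y by blast
  then have "A = Q"
    using \<open>Q \<subseteq> A\<close> by blast
  moreover have "card Q = j - 1"
    unfolding Q_def using d jle by (intro card_ap) auto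
  ultimately show ?thesis
    unfolding Q_def by (metis reverse_ap minus_minus)
qed

lemma ap_Suc_eq: "ap a d (Suc n) = insert a (ap (a + d) d n)"
proof -
  have "ap a d (Suc n) = insert a ((\<lambda>i. a + of_nat (Suc i) * d) ` {..<n})"
    unfolding ap_def lessThan_Suc_eq_insert_0 by (simp add: image_image)
  then show ?thesis
    by (simp add: ap_def algebra_simps)
qed

lemma ap_set_plus:
  assumes "0 < i" "0 < j"
  shows "ap a d i + ap b d j = ap (a + b) d (i + j - 1)"
proof (intro equalityI subsetI)
  fix x assume "x \<in> ap a d i + ap b d j"
  then obtain s t where "s < i" "t < j" "x = (a + of_nat s * d) + (b + of_nat t * d)"
    by (auto simp: ap_def set_plus_def)
  then show "x \<in> ap (a + b) d (i + j - 1)"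
    unfolding ap_def by (intro image_eqI[of _ _ "s + t"]) (auto simp: algebra_simps)
next
  fix x assume "x \<in> ap (a + b) d (i + j - 1)"
  then obtain s where s: "s < i + j - 1" "x = a + b + of_nat s * d"
    by (auto simp: ap_def)
  define u where "u = min s (i - 1)"
  have u: "u < i" "s - u < j" "s = u + (s - u)"
    using s assms by (auto simp: u_def min_def)
  have "x = (a + of_nat u * d) + (b + of_nat (s - u) * d)"
    using s(2) by (subst (asm) u(3), simp only: of_nat_add algebra_simps)
  then show "x \<in> ap a d i + ap b d j"
    using u by (intro set_plus_memI[of "a + of_nat u * d" _ "b + of_nat (s - u) * d"]) (auto simp: ap_def)
qed

text \<open>With \<open>P = {0, d} + P'\<close>, Cauchy-Davenport for
  \<open>({0, d} + A) + P'\<close> allows at most one new element in \<open>{0, d} + A\<close>, so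
  \<open>A\<close> has a single exit in direction \<open>d\<close>.\<close>

lemma ap_if_sumset_with_ap_small:
  fixes A P :: "'p::prime_card mod_ring set"
  assumes P: "P = ap b d n" "card P = n" "2 \<le> n" and A: "A \<noteq> {}"
    and small: "card (P + A) = card P + card A - 1" "card (P + A) < CARD('p)"
  shows "\<exists>a. A = ap a d (card A)"
proof -
  have d: "d \<noteq> 0"
  proof
    assume "d = 0"
    then have "P \<subseteq> {b}"
      using P(1) by (auto simp: ap_def)
    then show False
      using P card_mono[of "{b}" P] by auto
  qed
  have "P = ap b d (2 + (n - 1) - 1)"
    using P by simp
  also have "\<dots> = ap 0 d 2 + ap b d (n - 1)"
    using P(3) by (subst ap_set_plus) auto
  finally have P2: "P = ap 0 d 2 + ap b d (n - 1)" .
  have "A \<subseteq> ap 0 d 2 + A"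
    by (rule subset_set_plus_zero[of "ap 0 d 2", THEN order_trans])
       (auto simp: ap_def add.commute intro!: image_eqI[of _ _ 0])
  have "card A < CARD('p)"
    using small P by simp
  have ne: "ap 0 d 2 + A \<noteq> {}" "ap b d (n - 1) \<noteq> {}"
    using A P(3) \<open>A \<subseteq> _\<close> by (auto simp: ap_def lessThan_empty_iff)
  have cn: "card (ap b d (n - 1)) = n - 1"
    using d P(2,3) small by (intro card_ap) (auto simp: card_gt_0_iff)
  have "P + A = (ap 0 d 2 + A) + ap b d (n - 1)"
    by (simp add: P2 ac_simps)
  then have "min CARD('p) (card (ap 0 d 2 + A) + (n - 1) - 1) \<le> card (P + A)"
    using cauchy_davenport[OF ne] cn by simp
  then have le: "card (ap 0 d 2 + A) \<le> card A + 1"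
    using small P(2,3) by (simp add: min_def split: if_splits)
  let ?E = "(ap 0 d 2 + A) - A"
  have exitE: "x + d \<in> ?E" if "x \<in> A" "x + d \<notin> A" for x
    using that by (auto intro!: set_plus_memI[of d _ x] simp: ap_def intro!: image_eqI[of _ _ 1])
  have cE: "card ?E \<le> 1"
    using le \<open>A \<subseteq> ap 0 d 2 + A\<close> by (simp add: card_Diff_subset)
  have "A \<noteq> UNIV"
    using \<open>card A < CARD('p)\<close> by auto
  then obtain x where x: "x \<in> A" "x + d \<notin> A"
    using translation_closed_eq_UNIV[OF A d] by blast
  have "z + d = x + d" if "z \<in> A" "z + d \<notin> A" for z
    using cE exitE[OF x] exitE[OF that] card_le_Suc0_iff_eq[of ?E]
    by (metis One_nat_def finite)
  then show ?thesis
    using ap_of_one_exit[OF d A x(2)] by blast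
qed

lemma ap_UNIV:
  fixes d :: "'p::prime_card mod_ring"
  assumes "d \<noteq> 0"
  shows "ap a d CARD('p) = UNIV"
  using card_ap[OF assms order_refl] by (intro card_subset_eq) auto

lemma card_Compl_mod_ring: "card (- X) = CARD('p) - card X" for X :: "'p::prime_card mod_ring set"
  by (simp add: Compl_eq_Diff_UNIV card_Diff_subset)

lemma compl_ap:
  fixes d :: "'p::prime_card mod_ring"
  assumes "d \<noteq> 0" "n \<le> CARD('p)"
  shows "- ap a d n = ap (a + of_nat n * d) d (CARD('p) - n)"
proof -
  have "{..<CARD('p)} = {..<n} \<union> (\<lambda>i. n + i) ` {..<CARD('p) - n}"
  proof (intro equalityI subsetI)
    fix x assume x: "x \<in> {..<CARD('p)}"
    show "x \<in> {..<n} \<union> (\<lambda>i. n + i) ` {..<CARD('p) - n}"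
    proof (cases "x < n")
      case False
      then show ?thesis
        using x by (intro UnI2 image_eqI[of _ _ "x - n"]) auto
    qed simp
  qed (use assms(2) in auto)
  then have "UNIV = ap a d n \<union> ap (a + of_nat n * d) d (CARD('p) - n)"
    unfolding ap_UNIV[OF assms(1), of a, symmetric]
    by (simp add: ap_def image_Un image_image algebra_simps)
  then have "- ap a d n \<subseteq> ap (a + of_nat n * d) d (CARD('p) - n)"
    by blast
  moreover have "card (- ap a d n) = card (ap (a + of_nat n * d) d (CARD('p) - n))"
    using assms by (simp add: card_Compl_mod_ring card_ap)
  ultimately show ?thesis
    by (intro card_subset_eq) auto
qed

text \<open>Vosper's induction needs a transform that keeps two elements of \<open>B\<close>. If
  each one leaves \<open>B\<close> whole or cuts it to \<open>{0}\<close>, then the second kind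
  occurs for only one \<open>e\<close>, and \<open>(A - {e}) + B\<close> fits into \<open>A\<close>,
  which violates Cauchy-Davenport.\<close>

lemma exists_e_transform:
  fixes A B :: "'p::prime_card mod_ring set"
  assumes "2 \<le> card A" "0 \<in> B" "3 \<le> card B" and small: "card (A + B) \<le> card A + card B - 1"
    "card (A + B) < CARD('p)"
  shows "\<exists>e\<in>A. 2 \<le> card {b \<in> B. e + b \<in> A} \<and> card {b \<in> B. e + b \<in> A} < card B"
proof (rule ccontr)
  assume no: "\<not> ?thesis"
  have sub: "A \<subseteq> A + B"
    using assms(2) subset_set_plus_zero by blast
  have "A \<noteq> {}"
    using assms(1) by auto
  have "A \<noteq> UNIV"
    using small(2) sub by (metis CARD_mod_ring UNIV_I card_mono finite leD)
  obtain b where b: "b \<in> B" "b \<noteq> 0"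
    using ex_nonzero_mem[of B] assms(3) by auto
  define E where "E = {e \<in> A. \<not> (+) e ` B \<subseteq> A}"
  have "E \<noteq> {}"
    using exists_not_translate_subset[OF \<open>A \<noteq> {}\<close> \<open>A \<noteq> UNIV\<close> b] by (auto simp: E_def)
  \<comment> \<open>The critical size leaves no room: \<open>A\<close> and
    \<open>e + (B - {0})\<close> are disjoint and together as large as \<open>A + B\<close> can
    be.\<close>
  have AB: "A + B = A \<union> (+) e ` (B - {0})" "A \<inter> (+) e ` (B - {0}) = {}" if "e \<in> E" for e
  proof -
    have e: "e \<in> A"
      using that by (simp add: E_def)
    let ?B = "{b \<in> B. e + b \<in> A}"
    have "?B \<subset> B"
      using that by (auto simp: E_def)
    then have "card ?B < card B"
      by (simp add: psubset_card_mono)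
    then have "card ?B \<le> 1"
      using no e by auto
    moreover have "{0} \<subseteq> ?B"
      using e assms(2) by simp
    ultimately have B0: "?B = {0}"
      by (metis card_seteq finite is_singletonI is_singleton_altdef)
    then show disj: "A \<inter> (+) e ` (B - {0}) = {}"
      by blast
    have "A \<union> (+) e ` (B - {0}) \<subseteq> A + B"
      using sub e by (auto simp: set_plus_def)
    moreover have "card (A \<union> (+) e ` (B - {0})) = card A + card B - 1"
      using assms(2,3) by (simp add: card_Un_disjoint[OF _ _ disj] card_translate_set)
    ultimately show "A + B = A \<union> (+) e ` (B - {0})"
      using small(1) by (metis card_seteq finite)
  qed
  \<comment> \<open>Two elements of \<open>E\<close> would make \<open>B - {0}\<close> invariant
    under translation by their difference, yet it misses 0.\<close>
  have "e' = e" if "e \<in> E" "e' \<in> E" for e e'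
  proof (rule ccontr)
    assume "e' \<noteq> e"
    have eq: "(+) e ` (B - {0}) = (+) e' ` (B - {0})"
      using AB[OF that(1)] AB[OF that(2)] by blast
    have "x + (e - e') \<in> B - {0}" if "x \<in> B - {0}" for x
    proof -
      have "e + x \<in> (+) e' ` (B - {0})"
        using that eq by blast
      then obtain y where "y \<in> B - {0}" "e + x = e' + y"
        by blast
      then show ?thesis
        by (simp add: algebra_simps)
    qed
    then have "B - {0} = UNIV"
      using b \<open>e' \<noteq> e\<close> by (intro translation_closed_eq_UNIV[of _ "e - e'"]) auto
    then show False
      by blast
  qed
  then obtain e where e: "E = {e}"
    using \<open>E \<noteq> {}\<close> by blast
  then have eA: "e \<in> A"
    by (auto simp: E_def)
  have "x + b \<in> A" if "x \<in> A - {e}" "b \<in> B" for x b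
    using that e by (force simp: E_def)
  then have sub2: "(A - {e}) + B \<subseteq> A"
    by (auto simp: set_plus_def)
  have "A - {e} \<noteq> {}"
  proof
    assume "A - {e} = {}"
    then have "card A \<le> card {e}"
      by (intro card_mono) auto
    then show False
      using assms(1) by simp
  qed
  then have "min CARD('p) (card (A - {e}) + card B - 1) \<le> card ((A - {e}) + B)"
    using assms(2) by (intro cauchy_davenport) auto
  also have "\<dots> \<le> card A"
    by (rule card_mono[OF _ sub2]) simp
  finally have "CARD('p) \<le> card A \<or> card (A - {e}) + card B - 1 \<le> card A"
    by linarith
  moreover have "card (A - {e}) = card A - 1"
    using eA by simp
  moreover have "card A < CARD('p)"
    using small(2) card_mono[OF _ sub] by simp
  ultimately show False
    using assms(1,3) by linarith
qed

lemma sumset_compl: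
  fixes A B :: "'a::{ab_group_add,finite} set"
  shows "- (A + B) + uminus ` A \<subseteq> - B"
proof
  fix x assume "x \<in> - (A + B) + uminus ` A"
  then obtain y a where y: "y \<notin> A + B" "a \<in> A" "x = y - a"
    by (auto elim!: set_plus_elim)
  show "x \<in> - B"
  proof
    assume "x \<in> B"
    then have "y \<in> A + B"
      using y by (intro set_plus_memI[of a A x B]) auto
    then show False
      using y by blast
  qed
qed

lemma uminus_image_ap: "uminus ` ap a d n = ap (- a) (- d) n" for a d :: "'a::comm_ring_1"
  by (simp add: ap_def image_image)

text \<open>Induction on \<open>card B\<close>. The induction hypothesis, applied after a transform,
  shows that the sumset is a progression; passing to its complement recovers the two
  summands.\<close>

theorem vosper:
  fixes A B :: "'p::prime_card mod_ring set"
  assumes "2 \<le> card A" "2 \<le> card B" "card (A + B) = card A + card B - 1" "card (A + B) + 2 \<le> CARD('p)"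
  shows "\<exists>a b d. A = ap a d (card A) \<and> B = ap b d (card B)"
  using assms
proof (induction "card B" arbitrary: A B rule: less_induct)
  case less
  note prems = less.prems
  obtain b0 where b0: "b0 \<in> B"
    using prems by fastforce
  have ne: "A \<noteq> {}" "B \<noteq> {}"
    using prems by auto
  define C where "C = (+) (-b0) ` B"
  have C: "0 \<in> C" "card C = card B" "card (A + C) = card (A + B)"
    using b0 translate_set_plus[of 0 A "-b0" B]
    by (auto simp: C_def card_translate_set simp del: add_uminus_conv_diff uminus_add_conv_diff
        intro!: image_eqI[of _ _ b0])
  have BC: "B = (+) b0 ` C"
    by (simp add: C_def image_image)
  have C_ap: "\<exists>a b d. A = ap a d (card A) \<and> C = ap b d (card C)"
  proof (cases "card C = 2")
    case True
    obtain d where d: "C = {0, d}" "d \<noteq> 0"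
      using True C(1) unfolding card_2_iff by (metis insert_commute insertE singletonD)
    then have "C = ap 0 d 2"
      by (auto simp: ap_def numeral_2_eq_2 lessThan_Suc)
    moreover from this have "\<exists>a. A = ap a d (card A)"
      using True ne prems C by (intro ap_if_sumset_with_ap_small[of C 0 d 2 A]) (auto simp: add.commute)
    ultimately show ?thesis
      using True by metis
  next
    case False
    then have "3 \<le> card C"
      using C prems by simp
    moreover have "card (A + C) \<le> card A + card C - 1" "card (A + C) < CARD('p)"
      using prems C by linarith+
    ultimately obtain e where e: "e \<in> A"
      and ce: "2 \<le> card {b \<in> C. e + b \<in> A}" "card {b \<in> C. e + b \<in> A} < card C"
      using exists_e_transform[OF prems(1) C(1)] by blast
    let ?A = "A \<union> (+) e ` C" and ?C = "{b \<in> C. e + b \<in> A}"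
    note tr = e_transform[OF e C(1)]
    have "min CARD('p) (card ?A + card ?C - 1) \<le> card (?A + ?C)"
      using tr(3) e by (intro cauchy_davenport) auto
    moreover have le: "card (?A + ?C) \<le> card (A + C)"
      by (rule card_mono[OF _ tr(1)]) simp
    ultimately have eq: "card (?A + ?C) = card (A + C)"
      using tr(2) C prems by (simp add: min_def split: if_splits)
    \<comment> \<open>Cauchy-Davenport bounds the transformed sumset below by the size of
      \<open>A + C\<close>, so the transform lost nothing.\<close>
    then have AC: "?A + ?C = A + C"
      using tr(1) by (intro card_subset_eq) auto
    have cA: "card A \<le> card ?A"
      by (rule card_mono) auto
    obtain a b d where ab: "?A = ap a d (card ?A)" "?C = ap b d (card ?C)"
      using less.hyps[of ?C ?A] ce C eq tr(2) prems cA by fastforce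
    have d: "d \<noteq> 0"
    proof
      assume "d = 0"
      then have "?C \<subseteq> {b}"
        using ab(2) by (auto simp: ap_def)
      then show False
        using ce(1) card_mono[of "{b}" ?C] by auto
    qed
    have ACap: "A + C = ap (a + b) d (card (A + C))"
    proof -
      have "A + C = ap a d (card ?A) + ap b d (card ?C)"
        using AC ab by simp
      also have "\<dots> = ap (a + b) d (card ?A + card ?C - 1)"
        using ce cA prems by (intro ap_set_plus) auto
      finally show ?thesis
        using tr(2) C prems by simp
    qed
    \<comment> \<open>\<open>D\<close> is a progression with the same difference \<open>d\<close>,
      and \<open>D - A\<close> avoids \<open>C\<close>. Counting shows that \<open>D - A\<close> has
      critical size, so \<open>A\<close> is a progression with difference \<open>d\<close>; the
      critical size of \<open>A + C\<close> then gives the same for \<open>C\<close>.\<close>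
    define D where "D = - (A + C)"
    define n where "n = CARD('p) - card (A + C)"
    have cD: "card D = n"
      by (simp add: D_def n_def card_Compl_mod_ring)
    have "D = ap (a + b + of_nat (card (A + C)) * d) d n"
      unfolding D_def n_def using d prems C by (subst ACap, subst compl_ap) auto
    then obtain b' where D: "D = ap b' d n"
      by blast
    have DA: "D + uminus ` A \<subseteq> - C"
      unfolding D_def by (rule sumset_compl)
    have cA': "card (uminus ` A) = card A"
      by (simp add: card_image)
    have "min CARD('p) (card D + card (uminus ` A) - 1) \<le> card (D + uminus ` A)"
      using cD prems C ne by (intro cauchy_davenport) (auto simp: n_def)
    moreover have "card (D + uminus ` A) \<le> CARD('p) - card C"
      using card_mono[OF _ DA] by (simp add: card_Compl_mod_ring)
    ultimately have "card (D + uminus ` A) = card D + card (uminus ` A) - 1"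
      using prems C cD cA' unfolding n_def by linarith
    moreover have "card (D + uminus ` A) < CARD('p)"
      using \<open>card (D + uminus ` A) \<le> CARD('p) - card C\<close> prems C by linarith
    moreover have "2 \<le> n"
      using prems C unfolding n_def by linarith
    ultimately obtain a' where a': "uminus ` A = ap a' d (card A)"
      using ap_if_sumset_with_ap_small[OF D cD, of "uminus ` A"] ne cA' by auto
    have "A = uminus ` (uminus ` A)"
      by (simp add: image_image)
    then have "A = ap (- a') (- d) (card A)"
      unfolding a' uminus_image_ap by simp
    then obtain a'' where A: "A = ap a'' d (card A)"
      using reverse_ap[of "- a'" "- d" "card A"] by auto
    moreover obtain c' where "C = ap c' d (card C)"
      using ap_if_sumset_with_ap_small[OF A refl, of C] prems C ne by fastforce
    ultimately show ?thesis
      by blast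
  qed
  then obtain a b d where "A = ap a d (card A)" "C = ap b d (card C)"
    by blast
  moreover from this(2) have "B = ap (b0 + b) d (card B)"
    using BC C(2) by (metis (no_types, lifting) ap_def add.assoc image_cong image_image)
  ultimately show ?case
    by blast
qed

section \<open>Iterated sumsets\<close>

lemma hfold_sum_0: "hfold_sum 0 X = {0}"
  by (auto simp: hfold_sum_def)

lemma hfold_sum_Suc: "hfold_sum (Suc h) X = hfold_sum h X + X"
proof (intro equalityI subsetI)
  fix z assume "z \<in> hfold_sum (Suc h) X"
  then obtain x where "\<forall>i<Suc h. x i \<in> X" "z = (\<Sum>i<Suc h. x i)"
    by (auto simp: hfold_sum_def)
  then show "z \<in> hfold_sum h X + X"
    by (intro set_plus_memI[of "\<Sum>i<h. x i" _ "x h"]) (auto simp: hfold_sum_def)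
next
  fix z assume "z \<in> hfold_sum h X + X"
  then obtain x y where x: "\<forall>i<h. x i \<in> X" "y \<in> X" "z = (\<Sum>i<h. x i) + y"
    by (auto simp: hfold_sum_def set_plus_def)
  then show "z \<in> hfold_sum (Suc h) X"
    unfolding hfold_sum_def
    by (auto intro!: exI[of _ "\<lambda>i. if i = h then y else x i"])
qed

lemma hfold_sum_1: "hfold_sum (Suc 0) X = X"
  by (auto simp: hfold_sum_Suc hfold_sum_0 set_plus_def)

lemma hfold_sum_2: "hfold_sum 2 X = X + X"
  by (simp add: numeral_2_eq_2 hfold_sum_Suc hfold_sum_0 hfold_sum_1[unfolded hfold_sum_Suc hfold_sum_0])

lemma hfold_sum_add: "hfold_sum (i + j) X = hfold_sum i X + hfold_sum j X"
  by (induction j) (auto simp: hfold_sum_Suc hfold_sum_0 set_zero add.assoc)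

lemma hfold_sum_mult: "hfold_sum (i * j) X = hfold_sum i (hfold_sum j X)"
  by (induction i) (auto simp: hfold_sum_Suc hfold_sum_0 hfold_sum_add add.commute)

lemma hfold_sum_nonempty: "X \<noteq> {} \<Longrightarrow> hfold_sum h X \<noteq> {}"
  by (induction h) (auto simp: hfold_sum_Suc hfold_sum_0 set_plus_def)

lemma finite_hfold_sum: "finite X \<Longrightarrow> finite (hfold_sum h X)"
  by (induction h) (auto simp: hfold_sum_Suc hfold_sum_0 finite_set_plus)

lemma hfold_sum_contains:
  assumes "0 \<in> V" "1 \<le> h"
  shows "V \<subseteq> hfold_sum h V"
  using assms(2)
proof (induction h rule: dec_induct)
  case (step h)
  then show ?case
    unfolding hfold_sum_Suc using subset_set_plus_zero[OF assms(1)] by blast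
qed (simp add: hfold_sum_1)

lemma card_le_card_set_plus:
  fixes X Y :: "'a::{ab_group_add,finite} set"
  assumes "Y \<noteq> {}"
  shows "card X \<le> card (X + Y)"
proof -
  obtain y where "y \<in> Y"
    using assms by blast
  then have "(+) y ` X \<subseteq> X + Y"
    by (auto simp: set_plus_def add.commute)
  then show ?thesis
    by (metis card_mono card_translate_set finite)
qed

lemma card_hfold_sum_mono:
  fixes X :: "'a::{ab_group_add,finite} set"
  assumes "X \<noteq> {}" "i \<le> j"
  shows "card (hfold_sum i X) \<le> card (hfold_sum j X)"
  using card_le_card_set_plus[OF hfold_sum_nonempty[OF assms(1)]] hfold_sum_add[of i "j - i" X] assms(2)
  by (metis le_add_diff_inverse)

lemma card_hfold_sum_ge:
  fixes X :: "'p::prime_card mod_ring set"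
  assumes "X \<noteq> {}" "card (hfold_sum h X) < CARD('p)"
  shows "h * (card X - 1) + 1 \<le> card (hfold_sum h X)"
  using assms(2)
proof (induction h)
  case (Suc h)
  have le: "card (hfold_sum h X) \<le> card (hfold_sum (Suc h) X)"
    using card_hfold_sum_mono[OF assms(1)] by simp
  then have "h * (card X - 1) + 1 \<le> card (hfold_sum h X)"
    using Suc by simp
  moreover have "min CARD('p) (card (hfold_sum h X) + card X - 1) \<le> card (hfold_sum (Suc h) X)"
    unfolding hfold_sum_Suc using hfold_sum_nonempty assms(1) by (intro cauchy_davenport) auto
  moreover have "0 < card X"
    using assms(1) by (simp add: card_gt_0_iff)
  ultimately show ?case
    using Suc.prems by (simp add: min_def split: if_splits)
qed (simp add: hfold_sum_0)

text \<open>Fixing the length at \<open>card X\<close> forces the listed terms to be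
  distinct.\<close>

definition is_ap :: "'a::comm_semiring_1 set \<Rightarrow> bool" where
  "is_ap X \<longleftrightarrow> (\<exists>a d. X = ap a d (card X))"

text \<open>Vosper's theorem in contrapositive form: one more than Cauchy-Davenport gives.\<close>

lemma card_set_plus_not_ap:
  fixes X Y :: "'p::prime_card mod_ring set"
  assumes "\<not> is_ap Y" "2 \<le> card X" "2 \<le> card Y" "card (X + Y) + 2 \<le> CARD('p)"
  shows "card X + card Y \<le> card (X + Y)"
proof -
  have "X \<noteq> {}" "Y \<noteq> {}"
    using assms by auto
  then have "min CARD('p) (card X + card Y - 1) \<le> card (X + Y)"
    by (rule cauchy_davenport)
  moreover have "card (X + Y) \<noteq> card X + card Y - 1"
    using vosper[OF assms(2,3) _ assms(4)] assms(1) unfolding is_ap_def by metis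
  ultimately show ?thesis
    using assms(4) by linarith
qed

lemma card_hfold_sum_not_ap:
  fixes X :: "'p::prime_card mod_ring set"
  assumes "\<not> is_ap X" "2 \<le> card X" "1 \<le> h" "card (hfold_sum h X) + 2 \<le> CARD('p)"
  shows "h * card X \<le> card (hfold_sum h X)"
  using assms(3,4)
proof (induction h rule: dec_induct)
  case base
  show ?case
    by (simp add: hfold_sum_1)
next
  case (step h)
  have "X \<noteq> {}"
    using assms by auto
  then have le: "card (hfold_sum h X) \<le> card (hfold_sum (Suc h) X)" "card X \<le> card (hfold_sum h X)"
    using card_hfold_sum_mono[of X h "Suc h"] card_hfold_sum_mono[of X 1 h] step
    by (simp_all add: hfold_sum_1)
  then have "card (hfold_sum h X) + card X \<le> card (hfold_sum h X + X)"
    using step assms by (intro card_set_plus_not_ap) (auto simp: hfold_sum_Suc)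
  then show ?case
    using step le by (simp add: hfold_sum_Suc)
qed

section \<open>Multiples of integer sets with few holes\<close>

lemma residues_two_fold_sum:
  fixes S :: "nat set"
  assumes "S \<subseteq> {..L}" "L - 1 \<le> card S" "5 \<le> L" "r < L"
  shows "\<exists>x\<in>S. \<exists>y\<in>S. (x + y) mod L = r"
proof -
  define R where "R = S \<inter> {..<L}"
  have "finite S"
    using assms(1) finite_subset by blast
  have "S \<subseteq> insert L R"
    using assms(1) by (auto simp: R_def)
  then have "card S \<le> card R + 1"
    by (metis R_def Suc_eq_plus1 card_insert_le_m1 card_mono finite_Int finite_insert finite_lessThan
        card_insert_if le_SucI le_trans order_refl)
  then have cR: "L - 2 \<le> card R"
    using assms(2) by simp
  define f where "f x = (r + L - x) mod L" for x
  have "inj_on f {..<L}"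
  proof (rule inj_onI)
    fix x y assume xy: "x \<in> {..<L}" "y \<in> {..<L}" "f x = f y"
    then have "(r + L - x + (x + y)) mod L = (r + L - y + (x + y)) mod L"
      unfolding f_def by (metis mod_add_left_eq)
    then have "(r + L + y) mod L = (r + L + x) mod L"
      using xy by (simp add: algebra_simps)
    then have "[r + L + y = r + L + x] (mod L)"
      by (simp add: cong_def)
    then have "[y = x] (mod L)"
      by (simp add: cong_add_lcancel_nat)
    then show "x = y"
      using xy by (simp add: cong_def)
  qed
  then have "card (f ` R) = card R"
    by (intro card_image) (auto intro: inj_on_subset simp: R_def)
  moreover have "R \<union> f ` R \<subseteq> {..<L}"
    using assms by (auto simp: R_def f_def)
  then have "card (R \<union> f ` R) \<le> L"
    by (metis card_lessThan card_mono finite_lessThan)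
  moreover have "R \<inter> f ` R = {} \<Longrightarrow> card (R \<union> f ` R) = card R + card (f ` R)"
    by (intro card_Un_disjoint) (auto simp: R_def)
  \<comment> \<open>\<open>R\<close> and its reflection \<open>r - R\<close> modulo \<open>L\<close>
    each miss at most two of the \<open>L\<close> classes, so they meet once
    \<open>2 (L - 2) > L\<close>; this is where \<open>5 \<le> L\<close> enters.\<close>
  ultimately have "R \<inter> f ` R \<noteq> {}"
    using cR assms(3) by linarith
  then obtain x where x: "x \<in> R" "f x \<in> R"
    by blast
  have "(x + f x) mod L = (x + (r + L - x)) mod L"
    unfolding f_def by (simp add: mod_add_right_eq)
  also have "\<dots> = r"
    using x assms by (simp add: R_def)
  finally show ?thesis
    using x unfolding R_def by blast
qed

text \<open>
  Modulo \<open>L\<close> the set \<open>(h + 1) S\<close> meets every class, and its largest element in a class is not in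
  \<open>h S\<close>, since adding \<open>L \<in> S\<close> would make it larger.
\<close>

lemma card_hfold_sum_Suc_ge:
  fixes S :: "nat set"
  assumes "S \<subseteq> {..L}" "0 \<in> S" "L \<in> S" "L - 1 \<le> card S" "5 \<le> L" "1 \<le> h"
  shows "card (hfold_sum h S) + L \<le> card (hfold_sum (Suc h) S)"
proof -
  have fin: "finite S"
    using assms(1) finite_subset by blast
  let ?B = "hfold_sum h S" and ?C = "hfold_sum (Suc h) S"
  have finC: "finite ?C"
    by (rule finite_hfold_sum[OF fin])
  have BC: "?B \<subseteq> ?C"
    unfolding hfold_sum_Suc by (rule subset_set_plus_zero[OF assms(2)])
  have "S + S \<subseteq> ?C"
    unfolding hfold_sum_Suc using hfold_sum_contains[OF assms(2,6)] by (intro set_plus_mono2) auto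
  then have ex: "\<exists>z\<in>?C. z mod L = r" if "r < L" for r
    using residues_two_fold_sum[OF assms(1,4,5) that] by (auto simp: set_plus_def)
  define f where "f r = Max {z \<in> ?C. z mod L = r}" for r
  have f: "f r \<in> ?C" "f r mod L = r" "f r \<notin> ?B" if "r < L" for r
  proof -
    have "f r \<in> {z \<in> ?C. z mod L = r}"
      unfolding f_def using finC ex[OF that] by (intro Max_in) auto
    then show fr: "f r \<in> ?C" "f r mod L = r"
      by auto
    show "f r \<notin> ?B"
    proof
      assume "f r \<in> ?B"
      then have "f r + L \<in> ?C"
        unfolding hfold_sum_Suc using assms(3) by (rule set_plus_intro)
      then have "f r + L \<le> f r"
        using fr finC by (subst (2) f_def, intro Max_ge) auto
      then show False
        using assms(5) by simp
    qed
  qed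
  have "inj_on f {..<L}"
    using f(2) by (metis inj_onI lessThan_iff)
  then have "card (f ` {..<L}) = L"
    by (simp add: card_image)
  moreover have "card (?B \<union> f ` {..<L}) = card ?B + card (f ` {..<L})"
    using f(3) finite_hfold_sum[OF fin] by (intro card_Un_disjoint) auto
  moreover have "card (?B \<union> f ` {..<L}) \<le> card ?C"
    using BC f(1) finC by (intro card_mono) auto
  ultimately show ?thesis
    by linarith
qed

lemma hfold_sum_affine_image:
  fixes a d :: "'a::comm_semiring_1"
  shows "hfold_sum h ((\<lambda>i. a + of_nat i * d) ` S) = (\<lambda>i. of_nat h * a + of_nat i * d) ` hfold_sum h S"
proof (induction h)
  case (Suc h)
  have eq: "of_nat (Suc h) * a + of_nat (u + v) * d = (of_nat h * a + of_nat u * d) + (a + of_nat v * d)" for u v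
    by (simp add: algebra_simps)
  show ?case
    unfolding hfold_sum_Suc Suc set_plus_image
    by (simp only: image_image case_prod_beta eq) (auto simp: image_iff simp del: of_nat_Suc; blast)
qed (simp add: hfold_sum_0)

lemma hfold_sum_subset_atMost: "S \<subseteq> {..L} \<Longrightarrow> hfold_sum h S \<subseteq> {..h * L}" for S :: "nat set"
proof (induction h)
  case (Suc h)
  then show ?case
    by (fastforce simp: hfold_sum_Suc set_plus_def)
qed (simp add: hfold_sum_0)

lemma inj_on_ap:
  fixes d :: "'p::prime_card mod_ring"
  assumes "d \<noteq> 0"
  shows "inj_on (\<lambda>i. a + of_nat i * d) {..<CARD('p)}"
  using assms by (auto intro!: inj_onI simp: of_nat_mod_ring_eq_iff)

lemma ap_preimage: "S \<subseteq> ap a d n \<Longrightarrow> S = (\<lambda>i. a + of_nat i * d) ` {i \<in> {..<n}. a + of_nat i * d \<in> S}"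
  by (auto simp: ap_def)

text \<open>As \<open>h (m + 1) < p\<close>, the indices of the h-fold sums do not wrap around and
  can be counted as integers. The start \<open>card T = m\<close> is one below
  \<open>L = m + 1\<close>, and every further summand adds at least \<open>L\<close>.\<close>

lemma card_hfold_sum_two_holes:
  fixes S :: "'p::prime_card mod_ring set"
  assumes "d \<noteq> 0" "S \<subseteq> ap a d (m + 2)" "card S = m" "a \<in> S" "a + of_nat (m + 1) * d \<in> S"
    "4 \<le> m" "1 \<le> h" "h * (m + 1) < CARD('p)"
  shows "h * (m + 1) \<le> card (hfold_sum h S) + 1"
proof -
  define T where "T = {i \<in> {..<m + 2}. a + of_nat i * d \<in> S}"
  have S: "S = (\<lambda>i. a + of_nat i * d) ` T"
    unfolding T_def by (rule ap_preimage[OF assms(2)])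
  have T: "T \<subseteq> {..m + 1}" "0 \<in> T" "m + 1 \<in> T"
    using assms by (auto simp: T_def)
  have "h * (m + 1) \<ge> m + 1"
    using mult_le_mono1[OF assms(7), of "m + 1"] by simp
  then have "T \<subseteq> {..<CARD('p)}"
    using T assms(8) by force
  then have "inj_on (\<lambda>i. a + of_nat i * d) T"
    using inj_on_ap[OF assms(1)] inj_on_subset by blast
  then have cT: "card T = m"
    using assms(3) S card_image by metis
  have "i * (m + 1) \<le> card (hfold_sum i T) + 1" if "1 \<le> i" for i
    using that
  proof (induction i rule: dec_induct)
    case (step i)
    have "card (hfold_sum i T) + (m + 1) \<le> card (hfold_sum (Suc i) T)"
      using step assms cT T by (intro card_hfold_sum_Suc_ge) auto
    then show ?case
      using step by simp
  qed (simp add: hfold_sum_1 cT)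
  moreover have "hfold_sum h T \<subseteq> {..<CARD('p)}"
    using hfold_sum_subset_atMost[OF T(1), of h] assms(8) by auto
  then have "inj_on (\<lambda>i. of_nat h * a + of_nat i * d) (hfold_sum h T)"
    using inj_on_ap[OF assms(1)] inj_on_subset by blast
  then have "card (hfold_sum h S) = card (hfold_sum h T)"
    unfolding S hfold_sum_affine_image by (rule card_image)
  ultimately show ?thesis
    using assms(7) by simp
qed

text \<open>
  The doubles of the elements of \<open>S\<close> lie in the progression containing \<open>S + S\<close>. Their indices \<open>t\<close>
  in it satisfy \<open>t + t' = 2 x\<close> with \<open>x\<close> the index of the sum of the two elements, so that they all
  have the same parity.
\<close>

lemma subset_ap_if_double_ap:
  fixes S :: "'p::prime_card mod_ring set"
  assumes S2: "S + S \<subseteq> ap a d (2 * m + 2)" and d: "d \<noteq> 0" and p: "4 * m + 2 < CARD('p)"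
  shows "\<exists>b. S \<subseteq> ap b d (m + 1)"
proof -
  have two: "(2 :: 'p mod_ring) \<noteq> 0"
  proof -
    have "\<not> CARD('p) dvd 2 \<or> CARD('p) = 2"
      using prime_card primes_dvd_imp_eq two_is_prime_nat by blast
    moreover have "CARD('p) \<noteq> 2"
      using p by auto
    ultimately show ?thesis
      using of_nat_mod_ring_eq_0_iff[of 2, where ?'p = 'p] by simp
  qed
  have "\<exists>t. t < 2 * m + 2 \<and> s + s = a + of_nat t * d" if "s \<in> S" for s
  proof -
    have "s + s \<in> ap a d (2 * m + 2)"
      using S2 set_plus_intro[OF that that] by blast
    then show ?thesis
      by (auto simp: ap_def)
  qed
  then obtain t where t: "\<And>s. s \<in> S \<Longrightarrow> t s < 2 * m + 2" "\<And>s. s \<in> S \<Longrightarrow> s + s = a + of_nat (t s) * d"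
    by metis
  have even: "even (t s + t s')" if "s \<in> S" "s' \<in> S" for s s'
  proof -
    have "s + s' \<in> ap a d (2 * m + 2)"
      using S2 that by (auto simp: set_plus_def)
    then obtain x where x: "x < 2 * m + 2" "s + s' = a + of_nat x * d"
      by (auto simp: ap_def)
    have "a + of_nat (t s) * d + (a + of_nat (t s') * d) = (a + of_nat x * d) + (a + of_nat x * d)"
      using t(2)[OF that(1)] t(2)[OF that(2)] x(2) by (metis add.assoc add.commute)
    then have "of_nat (t s + t s') * d = of_nat (2 * x) * d"
      by (simp add: algebra_simps)
    then have "(of_nat (t s + t s') :: 'p mod_ring) = of_nat (2 * x)"
      using d by simp
    \<comment> \<open>Both sides are at most \<open>4 m + 2\<close>, hence below \<open>p\<close>,
      so equality in the field is equality of integers.\<close>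
    then have "t s + t s' = 2 * x"
      using t(1)[OF that(1)] t(1)[OF that(2)] x(1) p
      by (subst (asm) of_nat_mod_ring_eq_iff) auto
    then show ?thesis
      by simp
  qed
  show ?thesis
  proof (cases "S = {}")
    case False
    then obtain s0 where s0: "s0 \<in> S"
      by blast
    define e where "e = t s0 mod 2"
    have "s \<in> ap ((a + of_nat e * d) / 2) d (m + 1)" if "s \<in> S" for s
    proof -
      have "t s mod 2 = e"
        using even[OF that s0] unfolding e_def by presburger
      then have ts: "t s = e + 2 * (t s div 2)"
        by presburger
      have "s + s = a + of_nat e * d + 2 * (of_nat (t s div 2) * d)"
        using t(2)[OF that] by (subst (asm) ts) (simp add: algebra_simps)
      then have "s = (a + of_nat e * d) / 2 + of_nat (t s div 2) * d"
        using two by (simp add: field_simps)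
      then show ?thesis
        using t(1)[OF that] by (auto simp: ap_def)
    qed
    then show ?thesis
      by blast
  qed simp
qed

lemma ap_mono: "i \<le> j \<Longrightarrow> ap a d i \<subseteq> ap a d j"
  by (auto simp: ap_def)

lemma subset_ap_imp_nonzero:
  assumes "S \<subseteq> ap a d n" "2 \<le> card S"
  shows "d \<noteq> 0"
proof
  assume "d = 0"
  then have "S \<subseteq> {a}"
    using assms(1) by (auto simp: ap_def)
  then show False
    using assms(2) card_mono[of "{a}" S] by auto
qed

text \<open>For small \<open>S + S\<close> the covering property puts \<open>S\<close> into a
  progression of length \<open>m + 2\<close>, both ends of which must belong to \<open>S\<close>.
  For large \<open>S + S\<close>, even multiples of \<open>S\<close> are multiples of
  \<open>S + S\<close>, and an odd one has one more copy of \<open>S\<close>.\<close>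

lemma card_hfold_sum_not_in_short_ap:
  fixes S :: "'p::prime_card mod_ring set"
  assumes "card S = m" "4 \<le> m" and nocover: "\<And>a d. \<not> S \<subseteq> ap a d (m + 1)"
    and cover: "card (S + S) \<le> 2 * m + 1 \<Longrightarrow> \<exists>a d. S \<subseteq> ap a d (card (S + S) - m + 1)"
    and h: "1 \<le> h" "h * (m + 1) < CARD('p)" "card (hfold_sum h S) + 2 \<le> CARD('p)"
    and p: "4 * m + 2 < CARD('p)"
  shows "h * (m + 1) \<le> card (hfold_sum h S) + 1"
proof (cases "card (S + S) \<le> 2 * m + 1")
  case True
  then obtain a d where "S \<subseteq> ap a d (card (S + S) - m + 1)"
    using cover by blast
  moreover have "card (S + S) - m + 1 \<le> m + 2"
    using True by simp
  ultimately have S: "S \<subseteq> ap a d (m + 2)"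
    using ap_mono by (metis order_trans)
  have d: "d \<noteq> 0"
    using subset_ap_imp_nonzero[OF S] assms(1,2) by simp
  have "a \<in> S"
  proof (rule ccontr)
    assume "a \<notin> S"
    then have "S \<subseteq> ap (a + d) d (m + 1)"
      using S ap_Suc_eq[of a d "m + 1"] by auto
    then show False
      using nocover by blast
  qed
  moreover have "a + of_nat (m + 1) * d \<in> S"
  proof (rule ccontr)
    assume *: "a + of_nat (m + 1) * d \<notin> S"
    have "ap a d (m + 2) = insert (a + of_nat (m + 1) * d) (ap a d (m + 1))"
      by (simp add: ap_def lessThan_Suc)
    then have "S \<subseteq> ap a d (m + 1)"
      using S * by auto
    then show False
      using nocover by blast
  qed
  ultimately show ?thesis
    using card_hfold_sum_two_holes[OF d S] assms by blast
next
  case False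
  have ne: "S \<noteq> {}"
    using assms by auto
  have S_not_ap: "\<not> is_ap S"
    unfolding is_ap_def using nocover ap_mono[of m "m + 1"] assms(1) by (metis le_add1)
  have even_bound: "j * (2 * m + 2) \<le> card (hfold_sum (j * 2) S)"
    if "1 \<le> j" "card (hfold_sum (j * 2) S) + 2 \<le> CARD('p)" for j
  proof (cases "is_ap (S + S)")
    case True
    then obtain a d where ad: "S + S = ap a d (card (S + S))"
      unfolding is_ap_def by blast
    then have d: "d \<noteq> 0"
      using subset_ap_imp_nonzero[of "S + S" a d] False assms(2) by fastforce
    \<comment> \<open>If \<open>S + S\<close> were a progression of length \<open>2 m + 2\<close>,
      then \<open>S\<close> would lie in one of length \<open>m + 1\<close>. The extra element of
      \<open>S + S\<close> makes up for the weaker Cauchy-Davenport bound.\<close>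
    have "card (S + S) \<noteq> 2 * m + 2"
      using subset_ap_if_double_ap[of S a d m, OF _ d p] ad nocover by auto
    then have "2 * m + 2 \<le> card (S + S) - 1"
      using False by simp
    then have "j * (2 * m + 2) \<le> j * (card (S + S) - 1)"
      by (rule mult_le_mono2)
    moreover have "j * (card (S + S) - 1) + 1 \<le> card (hfold_sum j (S + S))"
      using that hfold_sum_nonempty[OF ne, of 2]
      by (intro card_hfold_sum_ge) (auto simp: hfold_sum_mult hfold_sum_2)
    ultimately show ?thesis
      by (simp add: hfold_sum_mult hfold_sum_2)
  next
    case nap: False
    have "j * (2 * m + 2) \<le> j * card (S + S)"
      using False by (intro mult_le_mono2) simp
    moreover have "j * card (S + S) \<le> card (hfold_sum j (S + S))"
      using nap that False by (intro card_hfold_sum_not_ap) (auto simp: hfold_sum_mult hfold_sum_2)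
    ultimately show ?thesis
      by (simp add: hfold_sum_mult hfold_sum_2)
  qed
  show ?thesis
  proof (cases "even h")
    case True
    then obtain j where "h = j * 2"
      by (metis dvd_def mult.commute)
    then show ?thesis
      using even_bound[of j] h by simp
  next
    case False
    then obtain j where j: "h = Suc (j * 2)"
      by (metis oddE Suc_eq_plus1 mult.commute)
    show ?thesis
    proof (cases "j = 0")
      case True
      then show ?thesis
        using j assms by (simp add: hfold_sum_1)
    next
      case False
      have le: "card (hfold_sum (j * 2) S) \<le> card (hfold_sum h S)"
        using card_hfold_sum_mono[OF ne] j by simp
      then have bound: "j * (2 * m + 2) \<le> card (hfold_sum (j * 2) S)"
        using even_bound[of j] False h by simp
      moreover have "1 * (2 * m + 2) \<le> j * (2 * m + 2)"
        using False by (intro mult_le_mono1) simp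
      \<comment> \<open>The last copy of \<open>S\<close>, which is no progression, adds
        \<open>m\<close>; the total \<open>j (2 m + 2) + m\<close> is exactly
        \<open>h (m + 1) - 1\<close>.\<close>
      ultimately have "card (hfold_sum (j * 2) S) + card S \<le> card (hfold_sum (j * 2) S + S)"
        using h(3) assms(1,2) unfolding j hfold_sum_Suc
        by (intro card_set_plus_not_ap[OF S_not_ap]) auto
      then show ?thesis
        using bound assms(1) unfolding j hfold_sum_Suc by simp
    qed
  qed
qed

section \<open>Coordinate sets of sum-free sets\<close>

lemma of_nat_mod_CARD: "(of_nat (n mod CARD('p)) :: 'p::prime_card mod_ring) = of_nat n"
  by (simp add: of_nat_eq_iff_cong_CHAR cong_def)

text \<open>Feasibility speaks about residues in \<open>{0..<q}\<close>; for \<open>q = p\<close>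
  the map \<open>of_nat\<close> identifies them with the field and \<open>sumset_mod\<close> with
  the sumset.\<close>

lemma covering_property_in_mod_ring:
  fixes S :: "'p::prime_card mod_ring set"
  assumes "feasible c t" "real (card S) \<le> c * CARD('p)" "real (card (S + S)) \<le> (2 + t) * card S - 3"
  shows "\<exists>a d. S \<subseteq> ap a d (card (S + S) - card S + 1)"
proof -
  define X where "X = {x \<in> {..<CARD('p)}. (of_nat x :: 'p mod_ring) \<in> S}"
  have inj: "inj_on (of_nat :: nat \<Rightarrow> 'p mod_ring) {..<CARD('p)}"
    using inj_on_ap[of "1 :: 'p mod_ring" 0] by simp
  have S: "S = of_nat ` X"
    unfolding X_def using surj_of_nat_mod_ring by (fastforce simp: image_iff)
  have cX: "card X = card S"
    unfolding S by (rule card_image[symmetric], rule inj_on_subset[OF inj]) (auto simp: X_def)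
  have SS: "S + S = of_nat ` sumset_mod CARD('p) X"
  proof (intro equalityI subsetI)
    fix z assume "z \<in> S + S"
    then obtain x y where "x \<in> X" "y \<in> X" "z = of_nat x + of_nat y"
      unfolding S by (auto simp: set_plus_def)
    then show "z \<in> of_nat ` sumset_mod CARD('p) X"
      by (intro image_eqI[of _ _ "(x + y) mod CARD('p)"]) (auto simp: of_nat_mod_CARD sumset_mod_def)
  next
    fix z :: "'p mod_ring" assume "z \<in> of_nat ` sumset_mod CARD('p) X"
    then show "z \<in> S + S"
      unfolding S by (force simp: of_nat_mod_CARD sumset_mod_def)
  qed
  have "sumset_mod CARD('p) X \<subseteq> {..<CARD('p)}"
    by (auto simp: sumset_mod_def)
  then have cSS: "card (sumset_mod CARD('p) X) = card (S + S)"
    unfolding SS by (intro card_image[symmetric] inj_on_subset[OF inj])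
  have "X \<subseteq> {0..<CARD('p)}"
    by (auto simp: X_def)
  moreover have "prime CARD('p)"
    by (rule prime_card)
  ultimately have "covering_property CARD('p) X"
    using assms cX cSS unfolding feasible_def by auto
  then obtain a d where "X \<subseteq> {(a + i * d) mod CARD('p) | i. i < card (S + S) - card S + 1}"
    unfolding covering_property_def cX cSS by blast
  then have "S \<subseteq> ap (of_nat a) (of_nat d) (card (S + S) - card S + 1)"
    unfolding S ap_def using of_nat_mod_CARD[where ?'p = 'p] by fastforce
  then show ?thesis
    by blast
qed

text \<open>The bound on \<open>Tfun c\<close> says that the supremum of the feasible values is at
  least \<open>5 / m\<close>, so some feasible value exceeds \<open>4 / m\<close>.\<close>

lemma exists_feasible_greater:
  assumes "5 * Tfun c \<le> of_nat m" "0 < m"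
  shows "\<exists>t. feasible c t \<and> 4 / real m < t"
proof -
  define s where "s = (SUP t\<in>{t. feasible c t}. ennreal t)"
  have "s \<le> 1"
    unfolding s_def by (rule SUP_least) (auto simp: feasible_def)
  then obtain x where x: "0 \<le> x" "s = ennreal x"
    by (metis ennreal_cases ennreal_one_neq_top top.extremum_uniqueI)
  have T: "5 * (1 / s) \<le> of_nat m"
    using assms(1) unfolding Tfun_def s_def by simp
  \<comment> \<open>A supremum 0, in particular the absence of feasible values, would make
    \<open>Tfun c\<close> infinite, against the bound \<open>m\<close>.\<close>
  have "x \<noteq> 0"
  proof
    assume "x = 0"
    then have "5 * (1 / s) = (top_class.top :: ennreal)"
      using x by (simp add: ennreal_mult_top)
    then show False
      using T by (simp add: ennreal_of_nat_neq_top top_unique)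
  qed
  then have "0 < x"
    using x by simp
  then have "5 * (1 / s) = ennreal (5 / x)"
    using x by (simp add: ennreal_times_divide divide_ennreal[symmetric])
  then have "ennreal (5 / x) \<le> ennreal (real m)"
    using T by (simp add: ennreal_of_nat_eq_real_of_nat)
  then have "5 / x \<le> real m"
    by (simp add: ennreal_le_iff)
  then have "4 / real m < x"
    using \<open>0 < x\<close> assms(2) by (simp add: field_simps)
  then have "ennreal (4 / real m) < s"
    using x assms(2) by (simp add: ennreal_less_iff)
  then obtain t where "feasible c t" "ennreal (4 / real m) < ennreal t"
    unfolding s_def less_SUP_iff by auto
  then show ?thesis
    using assms(2) by (auto simp: ennreal_less_iff)
qed

text \<open>Otherwise the bounds \<open>h (m + 1) - 1\<close> for \<open>h = k, l\<close> add up to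
  \<open>p + (k + l) - r - 4\<close>, which is more than \<open>p\<close>, the room for two disjoint
  sets.\<close>

lemma sum_free_subset_ap:
  fixes S :: "'p::prime_card mod_ring set"
  assumes "l < k" "1 \<le> l" "r + 5 \<le> k + l" "7 \<le> m" "k + l - 1 \<le> m"
    and T: "5 * Tfun (1 / real (k + l)) \<le> of_nat m" and p: "CARD('p) = (k + l) * m + 2 + r"
    and S: "card S = m" "hfold_sum k S \<inter> hfold_sum l S = {}"
  shows "\<exists>a d. S \<subseteq> ap a d (m + 1)"
proof (rule ccontr)
  assume "\<not> ?thesis"
  then have nocover: "\<not> S \<subseteq> ap a d (m + 1)" for a d
    by blast
  have cover: "\<exists>a d. S \<subseteq> ap a d (card (S + S) - m + 1)" if "card (S + S) \<le> 2 * m + 1"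
  proof -
    obtain t where t: "feasible (1 / real (k + l)) t" "4 / real m < t"
      using exists_feasible_greater[OF T] assms(4) by auto
    have "(k + l) * m \<le> CARD('p)"
      using p by simp
    then have "real (k + l) * real m \<le> real CARD('p)"
      by (metis of_nat_le_iff of_nat_mult)
    then have "real (card S) \<le> 1 / real (k + l) * CARD('p)"
      using assms(2) S by (simp add: field_simps)
    \<comment> \<open>This raises the feasibility threshold \<open>(2 + t) m - 3\<close> above
      \<open>2 m + 1\<close>.\<close>
    moreover have "4 < t * m"
      using t(2) assms(4) by (simp add: field_simps)
    then have "real (card (S + S)) \<le> (2 + t) * card S - 3"
      using that S by (simp add: algebra_simps)
    ultimately show ?thesis
      using covering_property_in_mod_ring[OF t(1), of S] S by simp
  qed
  have "5 * m \<le> (k + l) * m"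
    using assms(3) by (intro mult_le_mono1) simp
  then have p4: "4 * m + 2 < CARD('p)"
    using p assms(4) by linarith
  \<comment> \<open>\<open>h (m + 1)\<close> stays below \<open>p\<close> for
    \<open>h = k, l\<close>: the other one of \<open>k\<close> and \<open>l\<close> contributes at
    least \<open>m\<close> to \<open>p - h m\<close>, and \<open>k + l - 1 \<le> m\<close> gives
    \<open>h \<le> m\<close>.\<close>
  have "1 * m \<le> l * m" "1 * m \<le> k * m"
    using assms(1,2) by (intro mult_le_mono1; simp)+
  then have pk: "k * (m + 1) < CARD('p)" "l * (m + 1) < CARD('p)"
    using p assms(1,2,5) unfolding add_mult_distrib add_mult_distrib2 by linarith+
  have "card (hfold_sum k S) + card (hfold_sum l S) = card (hfold_sum k S \<union> hfold_sum l S)"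
    using S(2) by (simp add: card_Un_disjoint)
  also have "\<dots> \<le> CARD('p)"
    by (metis CARD_mod_ring card_mono finite subset_UNIV)
  finally have sum: "card (hfold_sum k S) + card (hfold_sum l S) \<le> CARD('p)" .
  \<comment> \<open>Each of the two disjoint multiples has at least \<open>m\<close> elements, so
    the other one misses at least two elements of the field, as the counting bound requires.\<close>
  have "S \<noteq> {}"
    using S assms(4) by auto
  then have "m \<le> card (hfold_sum k S)" "m \<le> card (hfold_sum l S)"
    using card_hfold_sum_mono[of S 1] S(1) assms(1,2) by (simp_all add: hfold_sum_1)
  then have "k * (m + 1) \<le> card (hfold_sum k S) + 1" "l * (m + 1) \<le> card (hfold_sum l S) + 1"
    using sum assms(1,2,4) S(1) pk p4
    by (intro card_hfold_sum_not_in_short_ap[of S m, OF _ _ nocover cover]; simp)+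
  then show False
    using sum p assms(3) by (simp add: algebra_simps)
qed

text \<open>A non-progression would give \<open>k S\<close> and \<open>l S\<close> at least
  \<open>(k + l) (m + 1)\<close> elements in total, while two sets with at most one common element
  have at most \<open>p + 1\<close>.\<close>

lemma almost_sum_free_is_ap:
  fixes S :: "'p::prime_card mod_ring set"
  assumes "l < k" "1 \<le> l" "r + 5 \<le> k + l" "7 \<le> m" and p: "CARD('p) = (k + l) * m + 2 + r"
    and S: "card S = m + 1" "card (hfold_sum k S \<inter> hfold_sum l S) \<le> 1"
  shows "is_ap S"
proof (rule ccontr)
  assume nap: "\<not> is_ap S"
  have "card (hfold_sum k S) + card (hfold_sum l S)
      = card (hfold_sum k S \<union> hfold_sum l S) + card (hfold_sum k S \<inter> hfold_sum l S)"
    by (rule card_Un_Int) auto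
  moreover have "card (hfold_sum k S \<union> hfold_sum l S) \<le> CARD('p)"
    by (metis CARD_mod_ring card_mono finite subset_UNIV)
  ultimately have sum: "card (hfold_sum k S) + card (hfold_sum l S) \<le> CARD('p) + 1"
    using S(2) by simp
  have "S \<noteq> {}"
    using S by auto
  then have "m + 1 \<le> card (hfold_sum k S)" "m + 1 \<le> card (hfold_sum l S)"
    using card_hfold_sum_mono[of S 1] S(1) assms(1,2) by (simp_all add: hfold_sum_1)
  then have "k * (m + 1) \<le> card (hfold_sum k S)" "l * (m + 1) \<le> card (hfold_sum l S)"
    using sum assms(1,2,4) S(1) card_hfold_sum_not_ap[OF nap, of k] card_hfold_sum_not_ap[OF nap, of l]
    by simp_all
  then show False
    using sum p assms(3) by (simp add: algebra_simps)
qed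

section \<open>Sum-free intervals and intervals with one hole\<close>

lemma hfold_sum_atMost: "hfold_sum h {..n} = {..h * n}" for n :: nat
proof (induction h)
  case (Suc h)
  have "{..h * n} + {..n} = {..Suc h * n}"
  proof (intro equalityI subsetI)
    fix x assume "x \<in> {..Suc h * n}"
    then show "x \<in> {..h * n} + {..n}"
      by (intro set_plus_memI[of "min x (h * n)" _ "x - min x (h * n)"]) (auto simp: min_def)
  qed (auto simp: set_plus_def)
  then show ?case
    by (simp only: hfold_sum_Suc Suc)
qed (auto simp: hfold_sum_0)

text \<open>\<open>D\<close> is the offset from \<open>k a\<close> to \<open>l a\<close>. The
  indices \<open>t\<close> of a k-fold sum and \<open>u\<close> of an l-fold sum name the same
  element when \<open>t = D + u\<close>, possibly after one wrap-around modulo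
  \<open>p\<close>.\<close>

lemma hfold_sum_common:
  fixes a :: "'p::prime_card mod_ring"
  assumes D: "of_nat l * a = of_nat k * a + of_nat D" and t: "t \<in> hfold_sum k T" and u: "u \<in> hfold_sum l T"
    and tu: "t = D + u \<or> t + CARD('p) = D + u"
  shows "of_nat k * a + of_nat t \<in> hfold_sum k ((\<lambda>i. a + of_nat i) ` T) \<inter> hfold_sum l ((\<lambda>i. a + of_nat i) ` T)"
proof -
  have "(of_nat t :: 'p mod_ring) = of_nat D + of_nat u"
    using tu by (metis add.right_neutral of_nat_add of_nat_card_eq_0)
  then have "of_nat k * a + of_nat t = of_nat l * a + of_nat u"
    by (simp add: D)
  moreover have "hfold_sum h ((\<lambda>i. a + of_nat i) ` T) = (\<lambda>i. of_nat h * a + of_nat i) ` hfold_sum h T" for h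
    using hfold_sum_affine_image[of h a 1 T] by simp
  ultimately show ?thesis
    using t u by (metis (no_types, lifting) IntI image_eqI)
qed

text \<open>The index intervals \<open>[0, k n]\<close> and \<open>[D, D + l n]\<close> must be
  disjoint modulo \<open>p\<close>. Otherwise the lower end of the second or its wrapped upper end
  is a common point; the latter is at most \<open>k n\<close> because \<open>l < k\<close>.\<close>

lemma interval_sum_free:
  fixes a :: "'p::prime_card mod_ring"
  assumes D: "of_nat l * a = of_nat k * a + of_nat D" "D < CARD('p)" and "l < k"
    and free: "hfold_sum k ((\<lambda>i. a + of_nat i) ` {..n}) \<inter> hfold_sum l ((\<lambda>i. a + of_nat i) ` {..n}) = {}"
  shows "k * n < D \<and> D + l * n < CARD('p)"
proof -
  have *: False if "t \<le> k * n" "u \<le> l * n" "t = D + u \<or> t + CARD('p) = D + u" for t u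
    using hfold_sum_common[OF D(1), of t "{..n}" u] that free by (simp add: hfold_sum_atMost)
  have "l * n \<le> k * n"
    using assms(3) by simp
  then have "D + l * n - CARD('p) \<le> k * n"
    using D(2) by linarith
  then show ?thesis
    using *[of D 0] *[of "D + l * n - CARD('p)" "l * n"] by (metis add.right_neutral le_add_diff_inverse2 le_refl not_less zero_le)
qed

text \<open>An overlap of the two index intervals in more than an endpoint would contain two
  consecutive indices, hence two common elements.\<close>

lemma interval_almost_sum_free:
  fixes a :: "'p::prime_card mod_ring"
  assumes D: "of_nat l * a = of_nat k * a + of_nat D" "D < CARD('p)" and "l < k" "1 \<le> l" "1 \<le> n" "k * n < CARD('p)"
    and free: "card (hfold_sum k ((\<lambda>i. a + of_nat i) ` {..n}) \<inter> hfold_sum l ((\<lambda>i. a + of_nat i) ` {..n})) \<le> 1"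
  shows "(k * n < D \<and> D + l * n < CARD('p)) \<or> D = k * n \<or> D + l * n = CARD('p)"
proof -
  let ?f = "\<lambda>i. a + of_nat i"
  have one: "x = y" if "x \<in> hfold_sum k (?f ` {..n}) \<inter> hfold_sum l (?f ` {..n})"
    "y \<in> hfold_sum k (?f ` {..n}) \<inter> hfold_sum l (?f ` {..n})" for x y
    using free that by (metis One_nat_def card_le_Suc0_iff_eq finite)
  have *: False if "t + 1 \<le> k * n" "u + 1 \<le> l * n" "t = D + u \<or> t + CARD('p) = D + u" for t u
  proof -
    have "of_nat k * a + of_nat t = of_nat k * a + of_nat (t + 1)"
      by (rule one; rule hfold_sum_common[OF D(1), where u = u] hfold_sum_common[OF D(1), where u = "u + 1"])
        (use that in \<open>auto simp: hfold_sum_atMost\<close>)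
    then show False
      by simp
  qed
  have "1 * 1 \<le> l * n"
    using assms by (intro mult_le_mono) auto
  then have "D < k * n \<Longrightarrow> False"
    using *[of D 0] by simp
  moreover have "CARD('p) < D + l * n \<Longrightarrow> False"
  proof -
    assume "CARD('p) < D + l * n"
    moreover have "1 * 1 \<le> k * n"
      using assms by (intro mult_le_mono) auto
    ultimately show False
      using *[of 0 "CARD('p) - D"] D(2) by fastforce
  qed
  ultimately show ?thesis
    by (metis linorder_neqE_nat)
qed

text \<open>For \<open>k = 2\<close> write \<open>t = 0 + t\<close>, or
  \<open>t = 1 + (t - 1)\<close> if the hole is \<open>t\<close>; sums above \<open>n\<close> are
  treated by reflection. Further summands are 0 or \<open>n\<close>. Only the second smallest and
  second largest sum can be lost, when the hole is next to an end.\<close>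

lemma hfold_sum_atMost_minus_hole:
  fixes h k n t :: nat
  assumes "0 < h" "h < n" "4 \<le> n" "2 \<le> k" "t \<le> k * n" "t = 1 \<Longrightarrow> h \<noteq> 1" "t + 1 = k * n \<Longrightarrow> h + 1 \<noteq> n"
  shows "t \<in> hfold_sum k ({..n} - {h})"
  using assms(4-7)
proof (induction k arbitrary: t rule: dec_induct)
  case base
  have *: "t \<in> hfold_sum 2 ({..n} - {h})" if "x \<le> n" "x \<noteq> h" "y \<le> n" "y \<noteq> h" "x + y = t" for x y
    unfolding hfold_sum_2 using that by (intro set_plus_memI[of x _ y]) auto
  show ?case
  proof (cases "t \<le> n")
    case True
    consider "h \<noteq> t" | "h = t" "t = 2" | "h = t" "3 \<le> t"
      using base(2) assms(1) by linarith
    then show ?thesis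
    proof cases
      case 1
      then show ?thesis
        using *[of 0 t] True assms(1) by simp
    next
      case 2
      then show ?thesis
        using *[of 1 1] assms(2) by simp
    next
      case 3
      then show ?thesis
        using *[of 1 "t - 1"] True by simp
    qed
  next
    case False
    define s where "s = 2 * n - t"
    have s: "t = 2 * n - s" "s < n"
      using False base assms by (auto simp: s_def)
    consider "n - h \<noteq> s" | "n - h = s" "s = 2" | "n - h = s" "3 \<le> s"
      using base(3) s assms(1-3) by linarith
    then show ?thesis
    proof cases
      case 1
      then show ?thesis
        using *[of n "n - s"] s assms(1-3) by simp
    next
      case 2
      then show ?thesis
        using *[of "n - 1" "n - 1"] s assms(1-3) by simp
    next
      case 3
      then show ?thesis
        using *[of "n - 1" "n - (s - 1)"] s assms(1-3) by simp
    qed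
  qed
next
  case (step k)
  have mem0: "z \<in> hfold_sum (Suc k) ({..n} - {h})" if "z \<in> hfold_sum k ({..n} - {h})" for z
    unfolding hfold_sum_Suc using that assms by (intro set_plus_memI[of z _ 0]) auto
  have memn: "z + n \<in> hfold_sum (Suc k) ({..n} - {h})" if "z \<in> hfold_sum k ({..n} - {h})" for z
    unfolding hfold_sum_Suc using that assms by (intro set_plus_memI[of z _ n]) auto
  have kn: "2 * n \<le> k * n"
    using step by (intro mult_le_mono1)
  show ?case
  proof (cases "t \<le> k * n \<and> (t + 1 = k * n \<longrightarrow> h + 1 \<noteq> n)")
    case True
    then show ?thesis
      using step by (intro mem0 step.IH) auto
  next
    case False
    \<comment> \<open>Subtracting \<open>n\<close> must not lead to the exceptional sum 1: either
      \<open>t - n\<close> is at least 2, or the hole is \<open>n - 1\<close>, which is not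
      1.\<close>
    have nt: "n + 2 \<le> t \<or> h + 1 = n \<and> n + 1 \<le> t"
      using False kn assms(3) by linarith
    have "t - n \<in> hfold_sum k ({..n} - {h})"
    proof (rule step.IH)
      show "t - n \<le> k * n" "t - n = 1 \<Longrightarrow> h \<noteq> 1"
        using step.prems nt assms(3) by auto
      assume "t - n + 1 = k * n"
      then have "t + 1 = Suc k * n"
        using nt unfolding mult_Suc by linarith
      then show "h + 1 \<noteq> n"
        using step.prems by blast
    qed
    moreover have "n \<le> t"
      using nt by linarith
    ultimately show ?thesis
      using memn[of "t - n"] by simp
  qed
qed

lemma mult_mem_hfold_sum: "x \<in> X \<Longrightarrow> of_nat h * x \<in> hfold_sum h X" for x :: "'a::comm_semiring_1"
  unfolding hfold_sum_def by (auto intro!: exI[of _ "\<lambda>_. x"])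

text \<open>The argument for full intervals applies unless the common index is one of the sums lost
  through the hole; then a nearby common index is used.\<close>

lemma punctured_interval_sum_free:
  fixes a :: "'p::prime_card mod_ring"
  assumes D: "of_nat l * a = of_nat k * a + of_nat D" "D < CARD('p)" and "l < k" "1 \<le> l" "2 \<le> k"
    and h: "0 < h" "h < n" "4 \<le> n"
    and free: "hfold_sum k ((\<lambda>i. a + of_nat i) ` ({..n} - {h})) \<inter> hfold_sum l ((\<lambda>i. a + of_nat i) ` ({..n} - {h})) = {}"
  shows "k * n < D \<and> D + l * n < CARD('p)"
proof -
  let ?T = "{..n} - {h}"
  have *: False if "t \<in> hfold_sum k ?T" "u \<in> hfold_sum l ?T" "t = D + u \<or> t + CARD('p) = D + u" for t u
    using hfold_sum_common[OF D(1) that] free by simp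
  obtain l' where l': "l = Suc l'"
    using assms(4) by (cases l) auto
  have near0: "u \<in> hfold_sum l ?T" if "u \<in> ?T" for u
    unfolding l' hfold_sum_Suc
    using mult_mem_hfold_sum[of 0 ?T l'] that h by (intro set_plus_memI[of 0 _ u]) auto
  have nearn: "l' * n + u \<in> hfold_sum l ?T" if "u \<in> ?T" for u
    unfolding l' hfold_sum_Suc
    using mult_mem_hfold_sum[of n ?T l'] that h by (intro set_plus_memI[of "l' * n" _ u]) auto
  have kT: "t \<in> hfold_sum k ?T" if "t \<le> k * n" "t = 1 \<Longrightarrow> h \<noteq> 1" "t + 1 = k * n \<Longrightarrow> h + 1 \<noteq> n" for t
    using hfold_sum_atMost_minus_hole[OF h assms(5) that] .
  have ln: "l * n + n \<le> k * n" "l * n = l' * n + n"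
    using mult_le_mono1[of "Suc l" k n] assms(3) l' by auto
  have "k * n < D"
  proof (rule ccontr)
    assume "\<not> k * n < D"
    \<comment> \<open>In the first two cases \<open>D\<close> itself is not a k-fold sum, and the
      common indices \<open>D + 2\<close> and \<open>D + 1\<close> replace it.\<close>
    then consider "D = 1" "h = 1" | "D + 1 = k * n" "h + 1 = n"
      | "D \<le> k * n" "D = 1 \<longrightarrow> h \<noteq> 1" "D + 1 = k * n \<longrightarrow> h + 1 \<noteq> n"
      by linarith
    then show False
    proof cases
      case 1
      then show False
        using *[of "D + 2" 2] kT[of "D + 2"] near0[of 2] h ln by auto
    next
      case 2
      then show False
        using *[of "D + 1" 1] kT[of "D + 1"] near0[of 1] h ln by auto
    next
      case 3
      then show False
        using *[of D 0] kT[of D] near0[of 0] h by auto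
    qed
  qed
  moreover have "D + l * n < CARD('p)"
  proof (rule ccontr)
    assume ge: "\<not> D + l * n < CARD('p)"
    show False
    \<comment> \<open>If the wrapped upper end is the lost sum 1, the common index 0 is used, with
      \<open>l n - 1\<close> on the other side.\<close>
    proof (cases "D + l * n - CARD('p) = 1 \<and> h = 1")
      case True
      have "0 + CARD('p) = D + (l' * n + (n - 1))"
        using True ln h by auto
      then show False
        using *[of 0 "l' * n + (n - 1)"] nearn[of "n - 1"] kT[of 0] True h ln by auto
    next
      case False
      have "D + l * n - CARD('p) \<in> hfold_sum k ?T"
        using False D(2) ln h by (intro kT) auto
      then show False
        using *[of "D + l * n - CARD('p)" "l' * n + n"] nearn[of n] ge h ln by auto
    qed
  qed
  ultimately show ?thesis
    by blast
qed

section \<open>Isomorphisms and fibres\<close>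

lemma isomorphic_sets_refl: "isomorphic_sets A A"
  unfolding isomorphic_sets_def by (intro exI[of _ id]) (auto simp: Modules.additive_def)

lemma isomorphic_sets_trans:
  assumes "isomorphic_sets A B" "isomorphic_sets B C"
  shows "isomorphic_sets A C"
proof -
  obtain f g where "bij f" "Modules.additive f" "f ` A = B" "bij g" "Modules.additive g" "g ` B = C"
    using assms unfolding isomorphic_sets_def by blast
  then show ?thesis
    unfolding isomorphic_sets_def
    by (intro exI[of _ "g \<circ> f"]) (auto simp: bij_comp Modules.additive_def image_comp[symmetric])
qed

lemma isomorphic_sets_card:
  assumes "isomorphic_sets A B"
  shows "card B = card A"
  using assms card_image[of _ A] unfolding isomorphic_sets_def by (metis bij_is_inj inj_on_subset subset_UNIV)

lemma hfold_sum_additive_image: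
  assumes "Modules.additive f"
  shows "hfold_sum h (f ` A) = f ` hfold_sum h A"
proof -
  interpret Modules.additive f
    by (rule assms)
  show ?thesis
  proof (induction h)
    case (Suc h)
    then show ?case
      unfolding hfold_sum_Suc set_plus_image by (force simp: add image_iff)
  qed (simp add: hfold_sum_0 zero)
qed

lemma isomorphic_sets_sum_free:
  assumes "isomorphic_sets A B" "sum_free k l A"
  shows "sum_free k l B"
proof -
  obtain f where f: "bij f" "Modules.additive f" "f ` A = B"
    using assms(1) unfolding isomorphic_sets_def by blast
  have "f ` hfold_sum k A \<inter> f ` hfold_sum l A = {}"
    using assms(2) f(1) unfolding sum_free_def by (metis bij_is_inj image_Int image_empty)
  then show ?thesis
    using assms(2) f unfolding sum_free_def by (metis hfold_sum_additive_image image_is_empty)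
qed

lemma isomorphic_sets_trivial:
  "isomorphic_sets A B \<Longrightarrow> trivial_set c k l m r B \<Longrightarrow> trivial_set c k l m r A"
  unfolding trivial_set_def using isomorphic_sets_trans by blast

lemma isomorphic_sets_normal:
  "isomorphic_sets A B \<Longrightarrow> normal_set c k l m r B \<Longrightarrow> normal_set c k l m r A"
  unfolding normal_set_def type1_def type2_def Let_def
  using isomorphic_sets_trans[of A B] isomorphic_sets_card[of A B] by metis

lemma isomorphic_sets_scale:
  fixes A :: "('p::prime_card mod_ring ^ 'n::finite) set"
  assumes "d \<noteq> 0"
  shows "isomorphic_sets A ((*s) d ` A)"
proof -
  have "bij ((*s) d :: 'p mod_ring ^ 'n \<Rightarrow> _)"
    by (rule bij_betw_byWitness[where f' = "(*s) (inverse d)"]) (use assms in auto)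
  then show ?thesis
    unfolding isomorphic_sets_def by (intro exI[of _ "(*s) d"]) (auto simp: Modules.additive_def vec.scale_right_distrib)
qed

text \<open>The shear fixes the coordinate \<open>c\<close> and can move a chosen point with nonzero
  coordinate onto the axis.\<close>

lemma isomorphic_sets_shear:
  fixes A :: "('p::prime_card mod_ring ^ 'n::finite) set"
  assumes "w $ c = 0"
  shows "isomorphic_sets A ((\<lambda>x. x - (x $ c) *s w) ` A)"
proof -
  have "bij (\<lambda>x. x - (x $ c) *s w)"
    by (rule bij_betw_byWitness[where f' = "\<lambda>x. x + (x $ c) *s w"]) (use assms in auto)
  then show ?thesis
    unfolding isomorphic_sets_def
    by (intro exI[of _ "\<lambda>x. x - (x $ c) *s w"]) (auto simp: Modules.additive_def vec.scale_left_distrib)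
qed

section \<open>Coordinate values and fibres\<close>

definition coords :: "'n::finite \<Rightarrow> ('a ^ 'n) set \<Rightarrow> 'a set" where
  "coords c A = (\<lambda>x. x $ c) ` A"

definition fibre :: "'n::finite \<Rightarrow> ('a ^ 'n) set \<Rightarrow> 'a \<Rightarrow> ('a ^ 'n) set" where
  "fibre c A i = {x \<in> A. x $ c = i}"

lemma coords_scale: "coords c ((*s) d ` A) = (*) d ` coords c A"
  by (simp add: coords_def image_image)

lemma coords_shear: "w $ c = 0 \<Longrightarrow> coords c ((\<lambda>x. x - (x $ c) *s w) ` A) = coords c A"
  for A :: "('a::ring ^ 'n::finite) set"
  by (simp add: coords_def image_image)

text \<open>A basis of \<open>K\<close> together with \<open>v\<close> is sent to the unit vectors,
  with \<open>v\<close> going to the one at \<open>c\<close>. Then \<open>x - i *s v \<in> K\<close>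
  says that the image of \<open>x\<close> has coordinate \<open>i\<close>, so \<open>omega\<close>
  counts coordinate values.\<close>

lemma decomposition_isomorphism:
  fixes v :: "'p::prime_card mod_ring ^ 'n::finite"
  assumes "decomposition v K"
  shows "\<exists>B. isomorphic_sets A B \<and> card (coords c B) = omega A v K"
proof -
  have K: "vec.subspace K" "vec.dim K = CARD('n) - 1" "v \<notin> K"
    using assms by (auto simp: decomposition_def)
  obtain E where E: "E \<subseteq> K" "vec.independent E" "K \<subseteq> vec.span E" "card E = CARD('n) - 1"
    using vec.basis_exists[of K] K(2) by metis
  have span: "vec.span E = K"
    using E K(1) by (metis vec.span_mono vec.span_eq_iff subset_antisym)
  have vE: "v \<notin> E"
    using E(1) K(3) by blast
  have indep: "vec.independent (insert v E)"
    unfolding vec.independent_insert using E(2) K(3) span by simp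
  have "card E = card (UNIV - {c})"
    using E(4) by simp
  then obtain b where b: "bij_betw b E (UNIV - {c})"
    using finite_same_card_bij[of E "UNIV - {c}"] finiteI_independent E(2)
    by (metis finite vec.finiteI_independent)
  obtain f where f: "Vector_Spaces.linear (*s) (*s) f"
    and fE: "\<forall>x\<in>insert v E. f x = (if x = v then axis c 1 else axis (b x) 1)"
    using vec.linear_independent_extend[OF indep, of "\<lambda>x. if x = v then axis c 1 else axis (b x) 1"] by blast
  interpret f: Vector_Spaces.linear "(*s)" "(*s)" f
    by (rule f)
  have "axis i 1 \<in> range f" for i
  proof (cases "i = c")
    case True
    then show ?thesis
      using fE by (metis insertI1 rangeI)
  next
    case False
    then obtain e where "e \<in> E" "b e = i"
      using b by (metis DiffI UNIV_I bij_betw_iff_bijections singletonD)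
    then show ?thesis
      using fE vE by (metis insertCI rangeI)
  qed
  moreover have "vec.subspace (range f)"
    using f.subspace_image[OF vec.subspace_UNIV] .
  ultimately have mem: "(\<Sum>i\<in>UNIV. x $ i *s axis i 1) \<in> range f" for x
    by (intro vec.subspace_sum vec.subspace_scale) auto
  have "surj f"
    using mem unfolding basis_expansion by blast
  then have "bij f"
    using finite_UNIV_surj_inj[OF finite, of f] by (simp add: bij_def)
  have fK: "f x $ c = 0" if "x \<in> K" for x
  proof -
    have "x \<in> vec.span E"
      using that span by simp
    then show ?thesis
    proof (induction rule: vec.span_induct_alt)
      case (step a e y)
      have "b e \<noteq> c" "e \<noteq> v"
        using step b vE by (auto simp: bij_betw_def)
      then show ?case
        using step fE by (auto simp: f.add f.scale axis_def)
    qed (simp add: f.zero)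
  qed
  have fv: "f v = axis c 1"
    using fE by simp
  have ex: "\<exists>i. x - i *s v \<in> K" for x
  proof -
    have "card (insert v E) = CARD('n)"
      using vE E(4) vec.finiteI_independent[OF E(2)] by simp
    then have "vec.dim (UNIV :: ('p mod_ring ^ 'n) set) \<le> card (insert v E)"
      using vec_dim_card[where ?'a = "'p mod_ring" and ?'n = 'n] by simp
    then have "vec.span (insert v E) = UNIV"
      using vec.card_ge_dim_independent[OF subset_UNIV indep] by blast
    then show ?thesis
      using vec.span_breakdown_eq[of x v E] span by auto
  qed
  have iff: "x - i *s v \<in> K \<longleftrightarrow> f x $ c = i" for x i
  proof
    show "f x $ c = i" if "x - i *s v \<in> K" for i
      using fK[OF that] fv by (simp add: f.diff f.scale)
    then show "f x $ c = i \<Longrightarrow> x - i *s v \<in> K"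
      using ex[of x] by metis
  qed
  have "{i. (\<lambda>x. x - i *s v) ` A \<inter> K \<noteq> {}} = coords c (f ` A)"
    unfolding coords_def using iff by (auto simp: image_iff)
  moreover have "isomorphic_sets A (f ` A)"
    unfolding isomorphic_sets_def using \<open>bij f\<close> by (intro exI[of _ f]) (auto simp: Modules.additive_def f.add)
  ultimately show ?thesis
    unfolding omega_def by metis
qed

lemma card_coord_eq: "card {x :: 'p::prime_card mod_ring ^ 'n::finite. x $ c = i} = CARD('p) ^ (CARD('n) - 1)"
proof -
  have eq: "card {x :: 'p mod_ring ^ 'n. x $ c = j} = card {x :: 'p mod_ring ^ 'n. x $ c = i}" for j
  proof -
    have "{x :: 'p mod_ring ^ 'n. x $ c = j} = (+) (axis c (j - i)) ` {x. x $ c = i}"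
    proof (intro equalityI subsetI)
      fix x :: "'p mod_ring ^ 'n" assume "x \<in> {x. x $ c = j}"
      then show "x \<in> (+) (axis c (j - i)) ` {x. x $ c = i}"
        by (intro image_eqI[of _ _ "x - axis c (j - i)"]) auto
    qed auto
    then show ?thesis
      by (simp add: card_translate_set)
  qed
  have "CARD('p) ^ CARD('n) = card (\<Union>j. {x :: 'p mod_ring ^ 'n. x $ c = j})"
  proof -
    have "(\<Union>j. {x :: 'p mod_ring ^ 'n. x $ c = j}) = UNIV"
      by auto
    then show ?thesis
      by (simp add: CARD_vec)
  qed
  also have "\<dots> = (\<Sum>j\<in>UNIV. card {x :: 'p mod_ring ^ 'n. x $ c = j})"
    by (rule card_UN_disjoint) auto
  also have "\<dots> = (\<Sum>j\<in>(UNIV :: 'p mod_ring set). card {x :: 'p mod_ring ^ 'n. x $ c = i})"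
    by (rule sum.cong[OF refl eq])
  also have "\<dots> = CARD('p) * card {x :: 'p mod_ring ^ 'n. x $ c = i}"
    by simp
  finally have "CARD('p) * CARD('p) ^ (CARD('n) - 1) = CARD('p) * card {x :: 'p mod_ring ^ 'n. x $ c = i}"
    by (metis One_nat_def Suc_pred power_Suc zero_less_card_finite)
  then show ?thesis
    by simp
qed

lemma card_fibre_le: "card (fibre c A i) \<le> CARD('p) ^ (CARD('n) - 1)"
  for A :: "('p::prime_card mod_ring ^ 'n::finite) set"
  unfolding card_coord_eq[of c i, symmetric] fibre_def by (intro card_mono) auto

lemma card_eq_sum_fibres: "card A = (\<Sum>i\<in>coords c A. card (fibre c A i))"
  for A :: "('p::prime_card mod_ring ^ 'n::finite) set"
proof -
  have "A = (\<Union>i\<in>coords c A. fibre c A i)"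
    by (auto simp: coords_def fibre_def)
  then have "card A = card (\<Union>i\<in>coords c A. fibre c A i)"
    by simp
  also have "\<dots> = (\<Sum>i\<in>coords c A. card (fibre c A i))"
    by (rule card_UN_disjoint) (auto simp: fibre_def)
  finally show ?thesis .
qed

lemma fibre_full:
  fixes A :: "('p::prime_card mod_ring ^ 'n::finite) set"
  assumes "card (fibre c A i) = CARD('p) ^ (CARD('n) - 1)" "x $ c = i"
  shows "x \<in> A"
proof -
  have "fibre c A i = {x. x $ c = i}"
    using assms(1) card_coord_eq[of c i]
    by (intro card_subset_eq) (auto simp: fibre_def)
  then show ?thesis
    using assms(2) by (auto simp: fibre_def)
qed

lemma sum_freeD:
  assumes "sum_free k l A" "\<And>q. q < k \<Longrightarrow> x q \<in> A" "\<And>q. q < l \<Longrightarrow> y q \<in> A"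
  shows "(\<Sum>q<k. x q) \<noteq> (\<Sum>q<l. y q)"
  using assms unfolding sum_free_def hfold_sum_def by blast

text \<open>A single signed sum lets positions on the two sides of the equation be treated
  alike.\<close>

lemma signed_sum_split:
  fixes a :: "nat \<Rightarrow> 'p::prime_card mod_ring ^ 'n::finite"
  shows "(\<Sum>q<k + l. (if q < k then 1 else - 1) *s a q) = (\<Sum>q<k. a q) - (\<Sum>q<l. a (k + q))"
  by (induction l) (auto simp: algebra_simps)

text \<open>
  If \<open>z\<close> is a solution of the equation in the coordinates, then two fibres occurring at different
  places in it cannot have more than \<open>p ^ (n - 1)\<close> elements together: otherwise these two places
  alone could be used to lift the solution to \<open>A\<close>.
\<close>

lemma card_two_fibres_le:
  fixes A :: "('p::prime_card mod_ring ^ 'n::finite) set"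
  assumes sf: "sum_free k l A" and z: "\<And>q. q < k + l \<Longrightarrow> z q \<in> coords c A"
    and eq: "(\<Sum>q<k. z q) = (\<Sum>q<l. z (k + q))" and q: "q1 \<noteq> q2" "q1 < k + l" "q2 < k + l"
  shows "card (fibre c A (z q1)) + card (fibre c A (z q2)) \<le> CARD('p) ^ (CARD('n) - 1)"
proof (rule ccontr)
  assume large: "\<not> ?thesis"
  have "\<exists>a. a \<in> A \<and> a $ c = z q" if "q < k + l" for q
    using z[OF that] by (auto simp: coords_def)
  then obtain a where a: "\<And>q. q < k + l \<Longrightarrow> a q \<in> A" "\<And>q. q < k + l \<Longrightarrow> a q $ c = z q"
    by metis
  define e :: "nat \<Rightarrow> 'p mod_ring" where "e q = (if q < k then 1 else - 1)" for q
  have e0: "e q \<noteq> 0" for q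
    by (simp add: e_def)
  define R where "R = {..<k + l} - {q1, q2}"
  have split: "(\<Sum>q<k + l. e q *s b q) = e q1 *s b q1 + (e q2 *s b q2 + (\<Sum>q\<in>R. e q *s b q))"
    for b :: "nat \<Rightarrow> 'p mod_ring ^ 'n"
  proof -
    have "{..<k + l} = insert q1 (insert q2 R)" "q1 \<notin> insert q2 R" "q2 \<notin> R" "finite R"
      using q by (auto simp: R_def)
    then show ?thesis
      by simp
  qed
  define g where "g = (\<Sum>q\<in>R. e q *s a q)"
  have zero: "(\<Sum>q<k + l. e q *s a q) $ c = 0"
    using signed_sum_split[where a = a] eq a(2) by (simp add: e_def)
  then have "e q1 * z q1 + (e q2 * z q2 + g $ c) = 0"
    unfolding split g_def[symmetric] by (simp add: a(2) q)
  then have "e q1 * z q1 = - (e q2 * z q2 + g $ c)"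
    by (simp only: eq_neg_iff_add_eq_0)
  then have zero': "- g $ c - e q2 * z q2 = e q1 * z q1"
    by simp
  \<comment> \<open>\<open>?X\<close> holds the terms available at \<open>q1\<close>, and
    \<open>?Y\<close> the terms needed there for the possible choices at \<open>q2\<close>. Both lie
    in one level set of \<open>p ^ (n - 1)\<close> elements, so they meet if they are too
    large.\<close>
  let ?X = "(*s) (e q1) ` fibre c A (z q1)" and ?Y = "(\<lambda>y. - g - e q2 *s y) ` fibre c A (z q2)"
  have "inj ((*s) (e q1) :: 'p mod_ring ^ 'n \<Rightarrow> _)" "inj (\<lambda>y :: 'p mod_ring ^ 'n. - g - e q2 *s y)"
    using e0 by (auto intro!: injI simp: vec.scale_cancel_left)
  then have cards: "card ?X = card (fibre c A (z q1))" "card ?Y = card (fibre c A (z q2))"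
    by (metis card_image inj_on_subset subset_UNIV)+
  have "?X \<union> ?Y \<subseteq> {x. x $ c = e q1 * z q1}"
    using zero' by (auto simp: fibre_def)
  then have "card (?X \<union> ?Y) \<le> CARD('p) ^ (CARD('n) - 1)"
    unfolding card_coord_eq[of c "e q1 * z q1", symmetric] by (intro card_mono) auto
  then have "?X \<inter> ?Y \<noteq> {}"
    using large cards by (metis card_Un_disjoint finite)
  then obtain x y where x: "x \<in> fibre c A (z q1)" and y: "y \<in> fibre c A (z q2)"
    and xy: "e q1 *s x = - g - e q2 *s y"
    by auto
  define b where "b = a(q1 := x, q2 := y)"
  have bA: "b q \<in> A" if "q < k + l" for q
    using a(1)[OF that] x y by (simp add: b_def fibre_def)
  have "(\<Sum>q\<in>R. e q *s b q) = g"
    unfolding g_def by (rule sum.cong) (auto simp: R_def b_def)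
  then have "(\<Sum>q<k + l. e q *s b q) = 0"
    unfolding split using xy q(1) by (simp add: b_def)
  then have "(\<Sum>q<k. b q) = (\<Sum>q<l. b (k + q))"
    using signed_sum_split[where a = b] by (simp add: e_def)
  then show False
    using sum_freeD[OF sf, of b "\<lambda>q. b (k + q)"] bA by simp
qed

section \<open>Cylinders over intervals\<close>

lemma mem_coord_prod_hyperplane: "x \<in> coord_prod c S (coord_hyperplane c) \<longleftrightarrow> x $ c \<in> S"
  for x :: "'p::prime_card mod_ring ^ 'n::finite"
proof
  assume "x $ c \<in> S"
  then show "x \<in> coord_prod c S (coord_hyperplane c)"
    unfolding coord_prod_def coord_hyperplane_def mem_Collect_eq
    by (intro exI[of _ "x $ c"] exI[of _ "x - axis c (x $ c)"]) auto
qed (auto simp: coord_prod_def coord_hyperplane_def)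

lemma coord_prod_hyperplane: "coord_prod c S (coord_hyperplane c) = {x. x $ c \<in> S}"
  using mem_coord_prod_hyperplane by blast

lemma cyc_interval_conv:
  fixes a b :: "'p::prime_card mod_ring"
  assumes "b = a + of_nat n" "n < CARD('p)"
  shows "cyc_interval a b = (\<lambda>i. a + of_nat i) ` {..n}"
proof -
  have "to_int_mod_ring (b - a) = int n"
    using assms by (simp add: of_nat_of_int_mod_ring)
  then have "cyc_interval a b = {a + of_int i | i. 0 \<le> i \<and> i \<le> int n}"
    by (simp add: cyc_interval_def)
  also have "\<dots> = (\<lambda>i. a + of_nat i) ` {..n}"
  proof (intro equalityI subsetI)
    fix x assume "x \<in> {a + of_int i | i. 0 \<le> i \<and> i \<le> int n}"
    then obtain i where i: "0 \<le> i" "i \<le> int n" "x = a + of_int i"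
      by blast
    then have "x = a + of_nat (nat i)"
      by simp
    then show "x \<in> (\<lambda>i. a + of_nat i) ` {..n}"
      using i by (intro image_eqI[of _ _ "nat i"]) auto
  next
    fix x assume "x \<in> (\<lambda>i. a + of_nat i) ` {..n}"
    then obtain i where "i \<le> n" "x = a + of_int (int i)"
      by auto
    then show "x \<in> {a + of_int i | i. 0 \<le> i \<and> i \<le> int n}"
      by (metis (mono_tags, lifting) mem_Collect_eq of_nat_0_le_iff of_nat_le_iff)
  qed
  finally show ?thesis .
qed

lemma of_nat_mem_cyc_interval:
  assumes "x \<le> d" "d \<le> y" "y < CARD('p::prime_card)"
  shows "(of_nat d :: 'p mod_ring) \<in> cyc_interval (of_nat x) (of_nat y)"
proof -
  have "(of_nat y :: 'p mod_ring) = of_nat x + of_nat (y - x)"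
    using assms by (simp flip: of_nat_add)
  then have "cyc_interval (of_nat x :: 'p mod_ring) (of_nat y) = (\<lambda>i. of_nat x + of_nat i) ` {..y - x}"
    using assms by (intro cyc_interval_conv) auto
  moreover have "(of_nat d :: 'p mod_ring) = of_nat x + of_nat (d - x)"
    using assms by (simp flip: of_nat_add)
  ultimately show ?thesis
    using assms by (auto intro!: image_eqI[of _ _ "d - x"])
qed

lemma uminus_interval:
  fixes b :: "'a::comm_ring_1"
  shows "(\<lambda>x. - 1 * x) ` ((\<lambda>i. b + of_nat i) ` {..n}) = (\<lambda>i. - (b + of_nat n) + of_nat i) ` {..n}"
proof (intro equalityI subsetI)
  fix x assume "x \<in> (\<lambda>x. - 1 * x) ` ((\<lambda>i. b + of_nat i) ` {..n})"
  then obtain i where "i \<le> n" "x = - (b + of_nat i)"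
    by auto
  then show "x \<in> (\<lambda>i. - (b + of_nat n) + of_nat i) ` {..n}"
    by (intro image_eqI[of _ _ "n - i"]) (auto simp: of_nat_diff)
next
  fix x assume "x \<in> (\<lambda>i. - (b + of_nat n) + of_nat i) ` {..n}"
  then obtain i where "i \<le> n" "x = - (b + of_nat n) + of_nat i"
    by auto
  then show "x \<in> (\<lambda>x. - 1 * x) ` ((\<lambda>i. b + of_nat i) ` {..n})"
    unfolding image_image by (intro image_eqI[of _ _ "n - i"]) (auto simp: of_nat_diff)
qed

lemma scale_coord_set:
  fixes S :: "'p::prime_card mod_ring set"
  assumes "d \<noteq> 0"
  shows "(*s) d ` {x :: 'p mod_ring ^ 'n::finite. x $ c \<in> S} = {x. x $ c \<in> (*) d ` S}"
proof (intro equalityI subsetI)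
  fix x :: "'p mod_ring ^ 'n" assume "x \<in> {x. x $ c \<in> (*) d ` S}"
  then obtain s where "s \<in> S" "x $ c = d * s"
    by auto
  then show "x \<in> (*s) d ` {x. x $ c \<in> S}"
    using assms by (intro image_eqI[of _ _ "inverse d *s x"]) (auto simp flip: mult.assoc)
qed auto

lemma of_nat_CARD_expand:
  assumes "CARD('p::prime_card) = (k + l) * m + 2 + r"
  shows "(of_nat k + of_nat l) * of_nat m + 2 + of_nat r = (0 :: 'p mod_ring)"
proof -
  have "(of_nat k + of_nat l) * of_nat m + 2 + of_nat r = (of_nat CARD('p) :: 'p mod_ring)"
    by (simp add: assms)
  then show ?thesis
    by simp
qed

lemma of_nat_diff_nonzero:
  assumes "l < k" "k < CARD('p::prime_card)"
  shows "(of_nat k :: 'p mod_ring) - of_nat l \<noteq> 0"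
  using assms of_nat_mod_ring_eq_iff[of k l, where ?'p = 'p] by auto

lemma trivial_if_coords_interval:
  fixes A :: "('p::prime_card mod_ring ^ 'n::finite) set"
  assumes kl: "l < k" "k < CARD('p)" "m < CARD('p)" and p: "CARD('p) = (k + l) * m + 2 + r"
    and sub: "coords c A \<subseteq> (\<lambda>i. b + of_nat i) ` {..m}"
    and D: "of_nat l * b = of_nat k * b + of_nat D" "k * m < D" "D + l * m < CARD('p)"
  shows "trivial_set c k l m r A"
proof -
  have nz: "(of_nat k :: 'p mod_ring) - of_nat l \<noteq> 0"
    by (rule of_nat_diff_nonzero[OF kl(1,2)])
  have cuboid: "extremal_cuboid c k l m j = {x :: 'p mod_ring ^ 'n. x $ c \<in> (\<lambda>i. a + of_nat i) ` {..m}}"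
    if "a * (of_nat k - of_nat l) = - of_nat (k * m + 1 + j)" for a j
  proof -
    have "a = - of_nat (k * m + 1 + j) * inverse (of_nat k - of_nat l)"
      using that nz by (metis eq_divide_imp divide_inverse)
    then show ?thesis
      unfolding extremal_cuboid_def Let_def coord_prod_hyperplane
      using cyc_interval_conv[OF refl kl(3), of a] by simp
  qed
  have sub': "B \<subseteq> {x. x $ c \<in> S}" if "coords c B \<subseteq> S" for B :: "('p mod_ring ^ 'n) set" and S
    using that by (auto simp: coords_def)
  define j where "j = D - k * m - 1"
  have j: "D = k * m + 1 + j" "j \<le> r"
    using D(2,3) p by (auto simp: j_def add_mult_distrib)
  \<comment> \<open>The upper bound on the index of a cuboid amounts to
    \<open>2 i \<le> r\<close>.\<close>
  have bound: "int i \<le> \<lceil>(real r + 1) / 2\<rceil> - 1" if "2 * i \<le> r" for i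
  proof -
    have "real (2 * i) \<le> real r"
      using that by simp
    then have "int i < \<lceil>(real r + 1) / 2\<rceil>"
      by (simp add: less_ceiling_iff)
    then show ?thesis
      by simp
  qed
  show ?thesis
  proof (cases "2 * j \<le> r")
    case True
    have "b * (of_nat k - of_nat l) = - of_nat (k * m + 1 + j)"
      using D(1) unfolding j(1)[symmetric] by (simp add: algebra_simps)
    then have "A \<subseteq> extremal_cuboid c k l m j"
      using sub'[OF sub] cuboid by simp
    then show ?thesis
      unfolding trivial_set_def using bound[OF True] isomorphic_sets_refl by blast
  next
    case False
    have "- (b + of_nat m) * (of_nat k - of_nat l) = of_nat D - of_nat k * of_nat m + of_nat l * of_nat m"
      using D(1) by (simp add: algebra_simps)
    also have "\<dots> = of_nat j + 1 + of_nat l * of_nat m"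
      by (simp add: j(1))
    also have "\<dots> = - of_nat (k * m + 1 + (r - j))"
      using of_nat_CARD_expand[OF p] j(2) by (simp add: of_nat_diff algebra_simps eq_neg_iff_add_eq_0)
    finally have cub: "extremal_cuboid c k l m (r - j)
        = {x :: 'p mod_ring ^ 'n. x $ c \<in> (\<lambda>i. - (b + of_nat m) + of_nat i) ` {..m}}"
      by (rule cuboid)
    have "coords c ((*s) (- 1) ` A) \<subseteq> (\<lambda>i. - (b + of_nat m) + of_nat i) ` {..m}"
      unfolding coords_scale uminus_interval[symmetric] by (rule image_mono[OF sub])
    then have "(*s) (- 1) ` A \<subseteq> extremal_cuboid c k l m (r - j)"
      unfolding cub by (rule sub')
    moreover have "int (r - j) \<le> \<lceil>(real r + 1) / 2\<rceil> - 1"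
      using False by (intro bound) simp
    moreover have "isomorphic_sets A ((*s) (- 1) ` A)"
      by (rule isomorphic_sets_scale) simp
    ultimately show ?thesis
      unfolding trivial_set_def by blast
  qed
qed

text \<open>The \<open>m\<close> fibres, of size at most \<open>p ^ (n - 1)\<close>, must all be
  full to reach \<open>card A\<close>. A solution among the coordinates then lifts to axis points,
  which belong to \<open>A\<close>.\<close>

lemma full_cylinder:
  fixes A :: "('p::prime_card mod_ring ^ 'n::finite) set"
  assumes sf: "sum_free k l A" and "card (coords c A) = m" "m * CARD('p) ^ (CARD('n) - 1) \<le> card A"
  shows "A = {x. x $ c \<in> coords c A}" "card A = m * CARD('p) ^ (CARD('n) - 1)"
    "hfold_sum k (coords c A) \<inter> hfold_sum l (coords c A) = {}"
proof -
  let ?N = "CARD('p) ^ (CARD('n) - 1)" and ?S = "coords c A"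
  have full: "card (fibre c A i) = ?N" if "i \<in> ?S" for i
  proof (rule ccontr)
    assume "card (fibre c A i) \<noteq> ?N"
    then have "card (fibre c A i) < ?N"
      using card_fibre_le[of c A i] by simp
    then have "(\<Sum>i\<in>?S. card (fibre c A i)) < (\<Sum>i\<in>?S. ?N)"
      using that card_fibre_le[of c A] by (intro sum_strict_mono_ex1) auto
    then show False
      using assms(2,3) card_eq_sum_fibres[of A c] by simp
  qed
  show A: "A = {x. x $ c \<in> ?S}"
  proof (intro equalityI subsetI)
    fix x assume "x \<in> {x. x $ c \<in> ?S}"
    then show "x \<in> A"
      using fibre_full[OF full refl] by blast
  qed (auto simp: coords_def)
  show "card A = m * ?N"
    using card_eq_sum_fibres[of A c] full assms(2) by simp
  show "hfold_sum k ?S \<inter> hfold_sum l ?S = {}"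
  proof (rule ccontr)
    assume "\<not> ?thesis"
    then obtain x y where xy: "\<forall>q<k. x q \<in> ?S" "\<forall>q<l. y q \<in> ?S" "(\<Sum>q<k. x q) = (\<Sum>q<l. y q)"
      unfolding hfold_sum_def by auto
    have axis_sum: "(\<Sum>q<h. axis c (x q)) = axis c (\<Sum>q<h. x q)" for h and x :: "nat \<Rightarrow> 'p mod_ring"
      by (induction h) (auto simp: vec_eq_iff axis_def)
    have "axis c s \<in> A" if "s \<in> ?S" for s
      using that by (subst A) simp
    then have "(\<Sum>q<k. axis c (x q)) \<noteq> (\<Sum>q<l. axis c (y q))"
      using xy by (intro sum_freeD[OF sf]) auto
    then show False
      using xy(3) axis_sum by simp
  qed
qed

text \<open>The interval is located by \<open>d\<close>, the quantity in the definition of type 1,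
  which ranges over \<open>[1, k + l + r + 1]\<close>. In two of five ranges one more point on the
  left or on the right gives an interval that makes the set trivial; the others are of type 1, the
  last one after a reflection.\<close>

lemma normal_if_interval_cylinder:
  fixes A :: "('p::prime_card mod_ring ^ 'n::finite) set"
  assumes kl: "l < k" "1 \<le> l" "k < CARD('p)" "m < CARD('p)" "1 \<le> m" and p: "CARD('p) = (k + l) * m + 2 + r"
    and A: "A = {x. x $ c \<in> (\<lambda>i. b + of_nat i) ` {..m - 1}}" "card A = m * CARD('p) ^ (CARD('n) - 1)"
    and free: "hfold_sum k ((\<lambda>i. b + of_nat i) ` {..m - 1}) \<inter> hfold_sum l ((\<lambda>i. b + of_nat i) ` {..m - 1}) = {}"
    and nontriv: "\<not> trivial_set c k l m r A"
  shows "normal_set c k l m r A"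
proof -
  obtain D where D: "D < CARD('p)" "of_nat l * b - of_nat k * b = of_nat D"
    using surj_of_nat_mod_ring by metis
  then have D': "of_nat l * b = of_nat k * b + of_nat D"
    by (simp add: algebra_simps)
  have Db: "k * (m - 1) < D" "D + l * (m - 1) < CARD('p)"
    using interval_sum_free[OF D' D(1) kl(1) free] by auto
  define d where "d = D - k * (m - 1)"
  have d: "1 \<le> d" "D = d + k * (m - 1)"
    using Db by (auto simp: d_def)
  have km: "k * (m - 1) + k = k * m" "l * (m - 1) + l = l * m"
    using kl(5) by (simp_all add: algebra_simps)
  have d_max: "d \<le> k + l + r + 1"
    using Db(2) d(2) km p by (simp add: add_mult_distrib)
  have coordsA: "coords c A \<subseteq> (\<lambda>i. b + of_nat i) ` {..m - 1}"
    unfolding A coords_def by auto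
  have m1: "(of_nat (m - 1) :: 'p mod_ring) = of_nat m - 1"
    using kl(5) by (simp add: of_nat_diff)
  have d_eq: "of_nat l * b - of_nat k * (b + of_nat m - 1) = of_nat d"
  proof -
    have "of_nat l * b = of_nat k * b + (of_nat d + of_nat k * (of_nat m - 1))"
      using D' unfolding d(2) by (simp only: of_nat_add of_nat_mult m1)
    then show ?thesis
      by (simp add: algebra_simps)
  qed
  have cyc: "cyc_interval a (a + of_nat m - 1) = (\<lambda>i. a + of_nat i) ` {..m - 1}" for a :: "'p mod_ring"
    using kl by (intro cyc_interval_conv) (auto simp: m1)
  have lp: "l < CARD('p)"
    using kl by simp
  have normal: "normal_set c k l m r A" if "type1 c k l m r A"
    unfolding normal_set_def using that A(2) by blast
  consider "d \<le> l" | "l < d" "d \<le> l + r + 1" | "r + l + 2 \<le> d" "d \<le> k" | "k < d" "d \<le> k + r + 1" | "k + r + 2 \<le> d"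
    by linarith
  then show ?thesis
  proof cases
    case 1
    have "of_nat d \<in> cyc_interval (of_nat 1) (of_nat l :: 'p mod_ring)"
      by (rule of_nat_mem_cyc_interval[OF d(1) 1 lp])
    moreover have "isomorphic_sets A (coord_prod c (cyc_interval b (b + of_nat m - 1)) (coord_hyperplane c))"
      unfolding cyc coord_prod_hyperplane A(1)[symmetric] by (rule isomorphic_sets_refl)
    ultimately show ?thesis
      by (intro normal) (auto simp: type1_def d_eq intro!: exI[of _ b])
  next
    case 2
    have "coords c A \<subseteq> (\<lambda>i. (b - 1) + of_nat i) ` {..m}"
    proof
      fix x assume "x \<in> coords c A"
      then obtain i where "i \<le> m - 1" "x = b + of_nat i"
        using coordsA by blast
      then show "x \<in> (\<lambda>i. (b - 1) + of_nat i) ` {..m}"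
        using kl(5) by (intro image_eqI[of _ _ "Suc i"]) auto
    qed
    \<comment> \<open>Prepending \<open>b - 1\<close> changes the offset to
      \<open>D + (k - l)\<close>; the bounds on \<open>d\<close> become the two inequalities for the
      longer interval.\<close>
    moreover have "of_nat l * (b - 1) = of_nat k * (b - 1) + of_nat (D + (k - l))"
      using D' kl(1) by (simp add: of_nat_diff algebra_simps)
    moreover have "k * m < D + (k - l)" "D + (k - l) + l * m < CARD('p)"
      using 2 km d(2) kl(1) p by (auto simp: add_mult_distrib)
    ultimately show ?thesis
      using trivial_if_coords_interval[OF kl(1,3,4) p] nontriv by blast
  next
    case 3
    have "of_nat d \<in> cyc_interval (of_nat (r + l + 2)) (of_nat k :: 'p mod_ring)"
      by (rule of_nat_mem_cyc_interval[OF 3 kl(3)])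
    moreover have "isomorphic_sets A (coord_prod c (cyc_interval b (b + of_nat m - 1)) (coord_hyperplane c))"
      unfolding cyc coord_prod_hyperplane A(1)[symmetric] by (rule isomorphic_sets_refl)
    moreover have "r + l + 2 \<le> k"
      using 3 by simp
    ultimately show ?thesis
      using d_eq by (intro normal) (metis type1_def)
  next
    case 4
    have "{..m - 1} \<subseteq> {..m}"
      by auto
    then have "coords c A \<subseteq> (\<lambda>i. b + of_nat i) ` {..m}"
      using coordsA by (metis image_mono order_trans)
    moreover have "k * m < D" "D + l * m < CARD('p)"
      using 4 km d(2) p by (auto simp: add_mult_distrib)
    ultimately show ?thesis
      using trivial_if_coords_interval[OF kl(1,3,4) p _ D'] nontriv by blast
  next
    case 5
    \<comment> \<open>Reflection in 0 turns \<open>d\<close> into \<open>k + l + r + 2 - d\<close>,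
      which lies in \<open>[1, l]\<close>.\<close>
    define a where "a = - (b + of_nat (m - 1))"
    define d' where "d' = k + l + r + 2 - d"
    have "1 \<le> d'" "d' \<le> l"
      using 5 d_max by (auto simp: d'_def)
    then have "of_nat d' \<in> cyc_interval (of_nat 1) (of_nat l :: 'p mod_ring)"
      using lp by (intro of_nat_mem_cyc_interval)
    moreover have "of_nat l * a - of_nat k * (a + of_nat m - 1) = of_nat d'"
    proof -
      have "(of_nat d' :: 'p mod_ring) = of_nat k + of_nat l + of_nat r + 2 - of_nat d"
        using d_max by (simp add: d'_def of_nat_diff)
      also have "\<dots> = of_nat l * a - of_nat k * (a + of_nat m - 1)
          + ((of_nat k + of_nat l) * of_nat m + 2 + of_nat r)"
        unfolding d_eq[symmetric] a_def m1 by (simp add: algebra_simps)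
      finally show ?thesis
        unfolding of_nat_CARD_expand[OF p] by simp
    qed
    moreover have "(*s) (- 1) ` A = coord_prod c (cyc_interval a (a + of_nat m - 1)) (coord_hyperplane c)"
      unfolding cyc coord_prod_hyperplane a_def uminus_interval[symmetric] A(1)
      by (rule scale_coord_set) simp
    then have "isomorphic_sets A (coord_prod c (cyc_interval a (a + of_nat m - 1)) (coord_hyperplane c))"
      using isomorphic_sets_scale[of "- 1" A] by simp
    ultimately show ?thesis
      by (intro normal) (auto simp: type1_def intro!: exI[of _ a])
  qed
qed

section \<open>The two cases\<close>

lemma scale_ap:
  fixes d :: "'p::prime_card mod_ring"
  assumes "d \<noteq> 0"
  shows "(*) (inverse d) ` ap a d (Suc n) = (\<lambda>i. inverse d * a + of_nat i) ` {..n}"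
proof -
  have "inverse d * (a + of_nat i * d) = inverse d * a + of_nat i" for i
    using assms by (simp add: distrib_left mult.left_commute[of "inverse d"])
  then show ?thesis
    by (simp add: ap_def image_image lessThan_Suc_atMost)
qed

lemma normal_if_few_coords:
  fixes A :: "('p::prime_card mod_ring ^ 'n::finite) set"
  assumes kl: "l < k" "1 \<le> l" "r + 5 \<le> k + l" "7 \<le> m" "k + l - 1 \<le> m"
    and T: "5 * Tfun (1 / real (k + l)) \<le> of_nat m" and p: "CARD('p) = (k + l) * m + 2 + r"
    and sf: "sum_free k l A" and nontriv: "\<not> trivial_set c k l m r A"
    and card: "m * CARD('p) ^ (CARD('n) - 1) \<le> card A" and S: "card (coords c A) = m"
  shows "normal_set c k l m r A"
proof -
  have "m \<le> (k + l) * m" "k + l \<le> (k + l) * m"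
    using kl by simp_all
  then have kp: "k < CARD('p)" "m < CARD('p)"
    using p kl(2) by linarith+
  obtain a d where ad: "coords c A \<subseteq> ap a d (m + 1)"
    using sum_free_subset_ap[OF kl T p S full_cylinder(3)[OF sf S card]] by blast
  have d: "d \<noteq> 0"
    using subset_ap_imp_nonzero[OF ad] S kl by simp
  \<comment> \<open>Scaling by the inverse of the difference turns the progression into an interval
    of \<open>m + 1\<close> points.\<close>
  define B where "B = (*s) (inverse d) ` A"
  define b where "b = inverse d * a"
  have iso: "isomorphic_sets A B"
    unfolding B_def using d by (intro isomorphic_sets_scale) simp
  have sfB: "sum_free k l B"
    by (rule isomorphic_sets_sum_free[OF iso sf])
  have cardB: "m * CARD('p) ^ (CARD('n) - 1) \<le> card B"
    using card isomorphic_sets_card[OF iso] by simp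
  have coordsB: "coords c B = (*) (inverse d) ` coords c A"
    by (simp add: B_def coords_scale)
  have SB: "card (coords c B) = m"
    unfolding coordsB S[symmetric] using d by (intro card_image) (auto intro!: inj_onI)
  have sub: "coords c B \<subseteq> (\<lambda>i. b + of_nat i) ` {..m}"
    unfolding coordsB b_def scale_ap[OF d, symmetric] using ad by (intro image_mono) simp
  have nontrivB: "\<not> trivial_set c k l m r B"
    using nontriv isomorphic_sets_trivial[OF iso] by blast
  note full = full_cylinder[OF sfB SB cardB]
  define U where "U = {i \<in> {..m}. b + of_nat i \<in> coords c B}"
  have U: "coords c B = (\<lambda>i. b + of_nat i) ` U"
    using sub by (auto simp: U_def)
  have "inj_on (\<lambda>i. b + of_nat i) U"
    by (rule inj_on_subset[of _ "{..<CARD('p)}"]) (use inj_on_ap[of 1 b] kp in \<open>auto simp: U_def\<close>)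
  then have "card U = m"
    using SB U by (simp add: card_image)
  then have "card ({..m} - U) = 1"
    by (subst card_Diff_subset) (auto simp: U_def)
  then obtain h where h: "{..m} - U = {h}"
    by (auto simp: card_1_singleton_iff)
  then have Uh: "U = {..m} - {h}" "h \<le> m"
    by (auto simp: U_def)
  have interval: "normal_set c k l m r B" if "coords c B = (\<lambda>i. b' + of_nat i) ` {..m - 1}" for b'
    using normal_if_interval_cylinder[OF kl(1,2) kp _ p, of B c b'] full nontrivB kl(4) unfolding that by simp
  have "normal_set c k l m r B"
  proof -
    \<comment> \<open>\<open>h\<close> is the only hole. At an end it leaves an interval of
      \<open>m\<close> points; in the interior it forces the set to be trivial.\<close>
    consider "h = 0" | "h = m" | "0 < h" "h < m"
      using Uh(2) by linarith
    then show ?thesis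
    proof cases
      case 1
      have "U = Suc ` {..m - 1}"
      proof (intro equalityI subsetI)
        fix x assume "x \<in> U"
        then show "x \<in> Suc ` {..m - 1}"
          using 1 Uh by (intro image_eqI[of _ _ "x - 1"]) auto
      qed (use 1 Uh kl(4) in auto)
      then have "coords c B = (\<lambda>i. (b + 1) + of_nat i) ` {..m - 1}"
        unfolding U by (simp add: image_image algebra_simps)
      then show ?thesis
        by (rule interval)
    next
      case 2
      then have "U = {..m - 1}"
        using Uh kl(4) by auto
      then show ?thesis
        using U by (intro interval[of b]) simp
    next
      case 3
      obtain D where D: "D < CARD('p)" "of_nat l * b - of_nat k * b = of_nat D"
        using surj_of_nat_mod_ring by metis
      then have D': "of_nat l * b = of_nat k * b + of_nat D"
        by (simp add: algebra_simps)
      have "k * m < D \<and> D + l * m < CARD('p)"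
        using full(3) kl unfolding U Uh(1)
        by (intro punctured_interval_sum_free[OF D' D(1) _ _ _ 3]) auto
      then show ?thesis
        using trivial_if_coords_interval[OF kl(1) kp p sub D'] nontrivB by blast
    qed
  qed
  then show ?thesis
    by (rule isomorphic_sets_normal[OF iso])
qed

section \<open>Sets with \<open>m + 1\<close> coordinate values\<close>

lemma card_fibres_pair:
  fixes A :: "('p::prime_card mod_ring ^ 'n::finite) set"
  assumes S: "card (coords c A) = m + 1" and card: "m * CARD('p) ^ (CARD('n) - 1) \<le> card A"
    and ij: "i \<in> coords c A" "j \<in> coords c A" "i \<noteq> j"
  defines "N \<equiv> CARD('p) ^ (CARD('n) - 1)"
  shows "N \<le> card (fibre c A i) + card (fibre c A j)"
    "card (fibre c A i) + card (fibre c A j) = N \<Longrightarrow> s \<in> coords c A \<Longrightarrow> s \<notin> {i, j} \<Longrightarrow> card (fibre c A s) = N"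
    "card (fibre c A i) + card (fibre c A j) = N \<Longrightarrow> card A = m * N"
proof -
  let ?R = "coords c A - {i, j}"
  have "card A = card (fibre c A i) + (card (fibre c A j) + (\<Sum>s\<in>?R. card (fibre c A s)))"
  proof -
    have "coords c A = insert i (insert j ?R)"
      using ij by auto
    then show ?thesis
      using card_eq_sum_fibres[of A c] ij(3) by (metis (no_types, lifting) Diff_iff finite insertCI insert_iff singletonD sum.insert)
  qed
  then have sum: "card A = card (fibre c A i) + card (fibre c A j) + (\<Sum>s\<in>?R. card (fibre c A s))"
    by simp
  have cR: "card ?R + 1 = m"
    using S ij card_mono[of "coords c A" "{i, j}"] by (simp add: card_Diff_subset)
  \<comment> \<open>The other \<open>m - 1\<close> fibres contain at most \<open>(m - 1) N\<close>
    elements, so the chosen two have at least \<open>N\<close> together; if they have exactly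
    \<open>N\<close>, there is no slack anywhere.\<close>
  have "(\<Sum>s\<in>?R. card (fibre c A s)) \<le> (\<Sum>s\<in>?R. N)"
    unfolding N_def by (intro sum_mono card_fibre_le)
  then have le: "(\<Sum>s\<in>?R. card (fibre c A s)) \<le> card ?R * N"
    by simp
  have mN: "m * N = card ?R * N + N"
    unfolding cR[symmetric] by simp
  show "N \<le> card (fibre c A i) + card (fibre c A j)"
    using sum le mN card unfolding N_def by linarith
  assume eq: "card (fibre c A i) + card (fibre c A j) = N"
  show "card A = m * N"
    using sum le mN card eq unfolding N_def by linarith
  assume s: "s \<in> coords c A" "s \<notin> {i, j}"
  show "card (fibre c A s) = N"
  proof (rule ccontr)
    assume "card (fibre c A s) \<noteq> N"
    then have "card (fibre c A s) < N"
      using card_fibre_le[of c A s] unfolding N_def by simp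
    then have "(\<Sum>s\<in>?R. card (fibre c A s)) < (\<Sum>s\<in>?R. N)"
      unfolding N_def using s card_fibre_le[of c A] by (intro sum_strict_mono_ex1) auto
    then show False
      using sum mN card eq unfolding N_def by simp
  qed
qed

lemma fibre_pos: "s \<in> coords c A \<Longrightarrow> 0 < card (fibre c A s)"
  for A :: "('p::prime_card mod_ring ^ 'n::finite) set"
  by (auto simp: coords_def fibre_def card_gt_0_iff)

text \<open>If 0 occurred, \<open>s + 0 + ... + 0\<close> would be a k-fold and an l-fold sum for
  every coordinate \<open>s\<close>, so each other fibre would have exactly
  \<open>p ^ (n - 1)\<close> elements together with the one over 0. Two different \<open>s\<close>
  then force the fibre over 0 to be empty.\<close>

lemma zero_notin_coords:
  fixes A :: "('p::prime_card mod_ring ^ 'n::finite) set"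
  assumes kl: "2 \<le> k" "1 \<le> l" "2 \<le> m" and sf: "sum_free k l A" and S: "card (coords c A) = m + 1"
    and card: "m * CARD('p) ^ (CARD('n) - 1) \<le> card A"
  shows "0 \<notin> coords c A"
proof
  assume 0: "0 \<in> coords c A"
  let ?N = "CARD('p) ^ (CARD('n) - 1)"
  have pair: "card (fibre c A s) + card (fibre c A 0) = ?N" if s: "s \<in> coords c A" "s \<noteq> 0" for s
  proof -
    \<comment> \<open>\<open>s\<close> stands once on each side, at positions 0 and
      \<open>k\<close>; position 1 carries 0 on the left side because
      \<open>2 \<le> k\<close>.\<close>
    let ?z = "\<lambda>q. if q = 0 \<or> q = k then s else 0"
    have "(\<Sum>q<k. ?z q) = (\<Sum>q<k. if q = 0 then s else 0)"
      by (rule sum.cong) auto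
    also have "\<dots> = s"
      using kl by (simp add: sum.delta)
    also have "\<dots> = (\<Sum>q<l. if q = 0 then s else 0)"
      using kl by (simp add: sum.delta)
    also have "\<dots> = (\<Sum>q<l. ?z (k + q))"
      using kl by (intro sum.cong) auto
    finally have "card (fibre c A (?z 0)) + card (fibre c A (?z 1)) \<le> ?N"
      using kl s 0 by (intro card_two_fibres_le[OF sf]) auto
    moreover have "1 \<noteq> k"
      using kl by simp
    ultimately have "card (fibre c A s) + card (fibre c A 0) \<le> ?N"
      by simp
    then show ?thesis
      using card_fibres_pair(1)[OF S card s(1) 0 s(2)] by simp
  qed
  have "2 \<le> card (coords c A - {0})"
    using S 0 kl by simp
  then obtain s t where st: "s \<in> coords c A - {0}" "t \<in> coords c A - {0}" "s \<noteq> t"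
    by (metis card_le_Suc0_iff_eq finite not_less_eq_eq numeral_2_eq_2)
  then have "card (fibre c A t) = ?N"
    using card_fibres_pair(2)[OF S card, of s 0 t] pair[of s] 0 by auto
  then show False
    using pair[of t] st fibre_pos[OF 0] by simp
qed

lemma odd_card_hyperplane:
  assumes "2 < CARD('p::prime_card)"
  shows "odd (CARD('p) ^ n)"
  using assms prime_card[where ?'a = 'p] prime_odd_nat by auto

lemma sum_one_exception:
  fixes z :: "nat \<Rightarrow> 'a::comm_ring_1"
  assumes "q0 < n" "z q0 = i" "\<And>q. q < n \<Longrightarrow> q \<noteq> q0 \<Longrightarrow> z q = j"
  shows "(\<Sum>q<n. z q) = of_nat n * j + (i - j)"
proof -
  have "(\<Sum>q<n. z q) = (\<Sum>q<n. j + (if q = q0 then i - j else 0))"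
    using assms by (intro sum.cong) auto
  then show ?thesis
    using assms(1) by (simp add: sum.distrib sum.delta)
qed

text \<open>
  In a solution inside the coordinate set exactly two values occur. Their fibres have
  \<open>p ^ (n - 1)\<close> elements together, which is an odd number, and the value with the larger fibre
  occurs only once.
\<close>

lemma coordinate_solution:
  fixes A :: "('p::prime_card mod_ring ^ 'n::finite) set"
  assumes kl: "l < k" "2 \<le> k" "1 \<le> l" "2 \<le> m" "k < CARD('p)" "2 < CARD('p)" and sf: "sum_free k l A"
    and S: "card (coords c A) = m + 1" and card: "m * CARD('p) ^ (CARD('n) - 1) \<le> card A"
    and v: "v \<in> hfold_sum k (coords c A) \<inter> hfold_sum l (coords c A)"
  shows "\<exists>i j. i \<in> coords c A \<and> j \<in> coords c A \<and> i \<noteq> j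
    \<and> card (fibre c A i) + card (fibre c A j) = CARD('p) ^ (CARD('n) - 1)
    \<and> card (fibre c A j) < card (fibre c A i)
    \<and> (v = of_nat l * j \<and> i + of_nat k * j = of_nat l * j + j \<or> v = of_nat k * j \<and> of_nat k * j + j = i + of_nat l * j)"
proof -
  let ?N = "CARD('p) ^ (CARD('n) - 1)"
  obtain x y where xy: "\<forall>q<k. x q \<in> coords c A" "\<forall>q<l. y q \<in> coords c A" "v = (\<Sum>q<k. x q)" "v = (\<Sum>q<l. y q)"
    using v unfolding hfold_sum_def by auto
  define z where "z q = (if q < k then x q else y (q - k))" for q
  have zS: "z q \<in> coords c A" if "q < k + l" for q
    using xy that by (auto simp: z_def)
  have vz: "v = (\<Sum>q<k. z q)" "v = (\<Sum>q<l. z (k + q))"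
    using xy by (auto simp: z_def)
  have two: "card (fibre c A (z q1)) + card (fibre c A (z q2)) \<le> ?N"
    if "q1 \<noteq> q2" "q1 < k + l" "q2 < k + l" for q1 q2
    using vz by (intro card_two_fibres_le[OF sf zS _ that]) auto
  have zero: "0 \<notin> coords c A"
    using zero_notin_coords[OF kl(2-4) sf S card] .
  \<comment> \<open>A constant solution would satisfy \<open>(k - l) z 0 = 0\<close>, but 0 is not a
    coordinate.\<close>
  have "\<exists>q<k + l. z q \<noteq> z 0"
  proof (rule ccontr)
    assume "\<not> ?thesis"
    then have const: "z q = z 0" if "q < k + l" for q
      using that by blast
    have "v = (\<Sum>q<k. z 0)"
      unfolding vz(1) by (intro sum.cong const) auto
    then have vk: "v = of_nat k * z 0"
      by simp
    have "v = (\<Sum>q<l. z 0)"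
      unfolding vz(2) by (intro sum.cong const) auto
    then have vl: "v = of_nat l * z 0"
      by simp
    have "(of_nat k - of_nat l) * z 0 = of_nat k * z 0 - of_nat l * z 0"
      by (rule left_diff_distrib)
    also have "\<dots> = 0"
      unfolding vk[symmetric] vl[symmetric] by (rule diff_self)
    finally have "z 0 = 0"
      using of_nat_diff_nonzero[OF kl(1,5)] by (metis mult_eq_0_iff)
    then show False
      using zS[of 0] zero kl(2) by simp
  qed
  then obtain q' where q': "q' < k + l" "z q' \<noteq> z 0"
    by blast
  have eq0: "card (fibre c A (z 0)) + card (fibre c A (z q')) = ?N"
  proof (rule antisym)
    show "card (fibre c A (z 0)) + card (fibre c A (z q')) \<le> ?N"
      using two[of 0 q'] q' kl(2) by fastforce
    show "?N \<le> card (fibre c A (z 0)) + card (fibre c A (z q'))"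
      using card_fibres_pair(1)[OF S card zS[of 0] zS[OF q'(1)]] q'(2) kl(2) by simp
  qed
  \<comment> \<open>A third value would have a full fibre, which cannot share a solution with a
    nonempty one.\<close>
  have vals: "z q \<in> {z 0, z q'}" if q: "q < k + l" for q
  proof (rule ccontr)
    assume ne: "z q \<notin> {z 0, z q'}"
    then have "card (fibre c A (z q)) = ?N"
      using card_fibres_pair(2)[OF S card zS[of 0] zS[OF q'(1)] _ eq0 zS[OF q]] q'(2) kl(2) by simp
    moreover have "card (fibre c A (z q)) + card (fibre c A (z 0)) \<le> ?N"
    proof (rule two[OF _ q])
      show "q \<noteq> 0"
        using ne by (metis insertI1)
    qed (use kl(2) in simp)
    moreover have "0 < card (fibre c A (z 0))"
      using zS[of 0] kl(2) by (intro fibre_pos) simp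
    ultimately show False
      by linarith
  qed
  have "card (fibre c A (z 0)) \<noteq> card (fibre c A (z q'))"
  proof
    assume "card (fibre c A (z 0)) = card (fibre c A (z q'))"
    then have "even ?N"
      unfolding eq0[symmetric] by (simp only: even_add)
    then show False
      using odd_card_hyperplane[OF kl(6), of "CARD('n) - 1"] by (rule notE[rotated])
  qed
  then have "\<exists>qi qj. {qi, qj} = {0, q'} \<and> card (fibre c A (z qj)) < card (fibre c A (z qi))"
    by (metis insert_commute linorder_neqE_nat)
  then obtain qi qj where qij: "{qi, qj} = {0, q'}" "card (fibre c A (z qj)) < card (fibre c A (z qi))"
    by blast
  have qq: "qi < k + l" "qj < k + l" "z qi \<noteq> z qj" "{z 0, z q'} = {z qi, z qj}"
    "card (fibre c A (z qj)) < card (fibre c A (z qi))"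
    "card (fibre c A (z qi)) + card (fibre c A (z qj)) = ?N"
    using qij q' eq0 kl(2) by (auto simp: doubleton_eq_iff)
  define i j where "i = z qi" and "j = z qj"
  \<comment> \<open>The larger fibre has more than half of \<open>p ^ (n - 1)\<close> elements, so
    its value cannot occur twice.\<close>
  have once: "z q = j" if q: "q < k + l" "q \<noteq> qi" for q
  proof (rule ccontr)
    assume "z q \<noteq> j"
    then have "z q = i"
      using vals[OF q(1)] qq(4) by (auto simp: i_def j_def)
    then show False
      using two[OF q(2) q(1) qq(1)] qq(5,6) by (simp add: i_def)
  qed
  \<comment> \<open>The side without the exceptional position consists of copies of \<open>j\<close>
    only, which determines \<open>v\<close>.\<close>
  have "v = of_nat l * j \<and> i + of_nat k * j = of_nat l * j + j \<or> v = of_nat k * j \<and> of_nat k * j + j = i + of_nat l * j"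
  proof (cases "qi < k")
    case True
    then have "v = of_nat k * j + (i - j)"
      unfolding vz(1) by (intro sum_one_exception[of qi]) (auto simp: i_def intro: once)
    moreover have "v = (\<Sum>q<l. j)"
      unfolding vz(2) using True by (intro sum.cong) (auto intro!: once)
    ultimately show ?thesis
      by (simp add: algebra_simps)
  next
    case False
    have "v = of_nat l * j + (i - j)"
      unfolding vz(2) using False qq(1)
      by (intro sum_one_exception[of "qi - k"]) (auto simp: i_def intro!: once)
    moreover have "v = (\<Sum>q<k. j)"
      unfolding vz(1) using False by (intro sum.cong) (auto intro!: once)
    ultimately show ?thesis
      by (simp add: algebra_simps)
  qed
  then show ?thesis
    using qq zS unfolding i_def j_def by metis
qed

text \<open>All fibres outside the pair from \<open>coordinate_solution\<close> are full, so every
  common sum has the same \<open>i\<close> and \<open>j\<close>. Two different common sums would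
  have \<open>i\<close> on different sides, whence \<open>2 (k - l) j = 0\<close>.\<close>

lemma card_common_sums_le:
  fixes A :: "('p::prime_card mod_ring ^ 'n::finite) set"
  assumes kl: "l < k" "2 \<le> k" "1 \<le> l" "2 \<le> m" "k < CARD('p)" "2 < CARD('p)" and sf: "sum_free k l A"
    and S: "card (coords c A) = m + 1" and card: "m * CARD('p) ^ (CARD('n) - 1) \<le> card A"
  shows "card (hfold_sum k (coords c A) \<inter> hfold_sum l (coords c A)) \<le> 1"
proof -
  let ?N = "CARD('p) ^ (CARD('n) - 1)" and ?F = "\<lambda>s. card (fibre c A s)"
  have "v = v'" if v: "v \<in> hfold_sum k (coords c A) \<inter> hfold_sum l (coords c A)"
    "v' \<in> hfold_sum k (coords c A) \<inter> hfold_sum l (coords c A)" for v v'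
  proof -
    obtain i j where ij: "i \<in> coords c A" "j \<in> coords c A" "i \<noteq> j" "?F i + ?F j = ?N" "?F j < ?F i"
      "v = of_nat l * j \<and> i + of_nat k * j = of_nat l * j + j \<or> v = of_nat k * j \<and> of_nat k * j + j = i + of_nat l * j"
      using coordinate_solution[OF kl sf S card v(1)] by blast
    obtain i' j' where ij': "i' \<in> coords c A" "j' \<in> coords c A" "i' \<noteq> j'" "?F i' + ?F j' = ?N" "?F j' < ?F i'"
      "v' = of_nat l * j' \<and> i' + of_nat k * j' = of_nat l * j' + j' \<or> v' = of_nat k * j' \<and> of_nat k * j' + j' = i' + of_nat l * j'"
      using coordinate_solution[OF kl sf S card v(2)] by blast
    have "s \<in> {i, j}" if "s \<in> coords c A" "?F s < ?N" for s
      using card_fibres_pair(2)[OF S card ij(1-4) that(1)] that(2) by auto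
    moreover have "?F i' < ?N" "?F j' < ?N"
      using ij'(4) fibre_pos[OF ij'(1)] fibre_pos[OF ij'(2)] by linarith+
    ultimately have "i' \<in> {i, j}" "j' \<in> {i, j}"
      using ij' by blast+
    then have same: "i' = i" "j' = j"
      using ij(3,5) ij'(3,5) by auto
    show "v = v'"
    proof (rule ccontr)
      assume "v \<noteq> v'"
      then have "i + of_nat k * j = of_nat l * j + j" "of_nat k * j + j = i + of_nat l * j"
        using ij(6) ij'(6) unfolding same by auto
      then have "i = of_nat l * j + j - of_nat k * j" "i = of_nat k * j + j - of_nat l * j"
        by (simp_all add: eq_diff_eq)
      then have "(of_nat k * j + j - of_nat l * j) - (of_nat l * j + j - of_nat k * j) = 0"
        by simp
      then have "2 * ((of_nat k - of_nat l) * j) = 0"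
        by (simp add: algebra_simps)
      moreover have "(2 :: 'p mod_ring) \<noteq> 0"
        using of_nat_mod_ring_eq_iff[of 2 0, where ?'p = 'p] kl(6) by simp
      ultimately have "j = 0"
        using of_nat_diff_nonzero[OF kl(1,5)] by simp
      then show False
        using zero_notin_coords[OF kl(2-4) sf S card] ij(2) by simp
    qed
  qed
  then show ?thesis
    by (metis One_nat_def card_le_Suc0_iff_eq finite)
qed

section \<open>Sets of type 2\<close>

lemma axis_add_eq: "axis c (x + y) = axis c x + (axis c y :: 'a::comm_monoid_add ^ 'n::finite)"
  by (simp add: vec_eq_iff axis_def)

text \<open>Scalars of the prime field are multiples of 1, so closure under addition
  suffices.\<close>

lemma subspace_if_closed:
  fixes V :: "('p::prime_card mod_ring ^ 'n::finite) set"
  assumes "0 \<in> V" "V + V \<subseteq> V"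
  shows "vec.subspace V"
proof (rule vec.subspaceI)
  show add: "x + y \<in> V" if "x \<in> V" "y \<in> V" for x y
    using assms(2) set_plus_intro[OF that] by blast
  show "t *s x \<in> V" if x: "x \<in> V" for t x
  proof -
    obtain n where t: "t = of_nat n"
      using surj_of_nat_mod_ring by metis
    have "of_nat n *s x \<in> V"
    proof (induction n)
      case (Suc n)
      have "of_nat (Suc n) *s x = x + of_nat n *s x"
        by (simp add: vec.scale_left_distrib)
      then show ?case
        using add[OF x Suc] by simp
    qed (use assms(1) in simp)
    then show ?thesis
      unfolding t .
  qed
qed (rule assms(1))

lemma card_fibre_hyperplane:
  fixes A :: "('p::prime_card mod_ring ^ 'n::finite) set"
  shows "card {w \<in> coord_hyperplane c. axis c i + w \<in> A} = card (fibre c A i)"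
proof -
  have "fibre c A i = (+) (axis c i) ` {w \<in> coord_hyperplane c. axis c i + w \<in> A}"
  proof (intro equalityI subsetI)
    fix x assume "x \<in> fibre c A i"
    then show "x \<in> (+) (axis c i) ` {w \<in> coord_hyperplane c. axis c i + w \<in> A}"
      by (intro image_eqI[of _ _ "x - axis c i"]) (auto simp: fibre_def coord_hyperplane_def)
  qed (auto simp: fibre_def coord_hyperplane_def)
  then show ?thesis
    by (simp add: card_translate_set)
qed

lemma mem_coord_prod_singleton:
  "x \<in> coord_prod c {i} W \<longleftrightarrow> x $ c = i \<and> x - axis c i \<in> W"
  if "W \<subseteq> coord_hyperplane c" for x :: "'p::prime_card mod_ring ^ 'n::finite"
proof
  assume "x \<in> coord_prod c {i} W"
  then obtain w where "w \<in> W" "x = axis c i + w"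
    by (auto simp: coord_prod_def)
  then show "x $ c = i \<and> x - axis c i \<in> W"
    using that by (auto simp: coord_hyperplane_def)
next
  assume "x $ c = i \<and> x - axis c i \<in> W"
  then show "x \<in> coord_prod c {i} W"
    unfolding coord_prod_def mem_Collect_eq
    by (intro exI[of _ i] exI[of _ "x - axis c i"]) auto
qed

text \<open>\<open>V\<close> and \<open>Y\<close> describe the fibres over the right and the left
  end. Since \<open>a = k (a + m)\<close>, sum-freeness separates \<open>k V\<close> from
  \<open>Y\<close>; with \<open>0 \<in> V\<close> and \<open>card Y + card V = p ^ (n - 1)\<close>
  this makes both \<open>V\<close> and \<open>k V\<close> the complement of \<open>Y\<close>, so
  \<open>V\<close> is closed under addition.\<close>

lemma normal_type2_aux:
  fixes A :: "('p::prime_card mod_ring ^ 'n::finite) set"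
  assumes k: "2 \<le> k" "k < CARD('p)" "2 \<le> m" "m < CARD('p)" and n: "2 \<le> CARD('n)"
    and sf: "sum_free k 1 A" and S: "coords c A = (\<lambda>i. a + of_nat i) ` {..m}"
    and F: "card (fibre c A a) + card (fibre c A (a + of_nat m)) = CARD('p) ^ (CARD('n) - 1)"
    and full: "\<And>s. s \<in> coords c A \<Longrightarrow> s \<notin> {a, a + of_nat m} \<Longrightarrow> card (fibre c A s) = CARD('p) ^ (CARD('n) - 1)"
    and cardA: "card A = m * CARD('p) ^ (CARD('n) - 1)"
    and a: "a = of_nat k * (a + of_nat m)" and ax: "axis c (a + of_nat m) \<in> A"
  shows "normal_set c k 1 m r A"
proof -
  let ?H = "coord_hyperplane c :: ('p mod_ring ^ 'n) set" and ?j = "a + of_nat m"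
  let ?N = "CARD('p) ^ (CARD('n) - 1)"
  define V where "V = {w \<in> ?H. axis c ?j + w \<in> A}"
  define Y where "Y = {w \<in> ?H. axis c a + w \<in> A}"
  have cVY: "card Y + card V = ?N"
    using F unfolding V_def Y_def card_fibre_hyperplane by simp
  have cH: "card ?H = ?N"
    unfolding coord_hyperplane_def by (rule card_coord_eq)
  have V0: "0 \<in> V"
    using ax by (simp add: V_def coord_hyperplane_def)
  have VH: "V \<subseteq> ?H" and YH: "Y \<subseteq> ?H"
    by (auto simp: V_def Y_def)
  have kV_A: "axis c (of_nat h * ?j) + w \<in> hfold_sum h A \<and> w \<in> ?H" if "w \<in> hfold_sum h V" for h w
    using that
  proof (induction h arbitrary: w)
    case 0
    then show ?case
      by (simp add: hfold_sum_0 coord_hyperplane_def)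
  next
    case (Suc h)
    then obtain u v where uv: "u \<in> hfold_sum h V" "v \<in> V" "w = u + v"
      unfolding hfold_sum_Suc by (auto elim: set_plus_elim)
    have "axis c (of_nat (Suc h) * ?j) + w = (axis c (of_nat h * ?j) + u) + (axis c ?j + v)"
    proof -
      have "axis c (of_nat (Suc h) * ?j) = axis c (of_nat h * ?j) + (axis c ?j :: 'p mod_ring ^ 'n)"
        unfolding axis_add_eq[symmetric] of_nat_Suc distrib_right[of 1] by (simp only: mult_1 add.commute)
      then show ?thesis
        unfolding uv(3) by (simp only: ac_simps)
    qed
    moreover have v: "axis c ?j + v \<in> A" "v \<in> ?H"
      using uv(2) by (simp_all add: V_def)
    ultimately have "axis c (of_nat (Suc h) * ?j) + w \<in> hfold_sum (Suc h) A"
      unfolding hfold_sum_Suc using Suc.IH[OF uv(1)] set_plus_intro by metis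
    moreover have "w \<in> ?H"
      using Suc.IH[OF uv(1)] v(2) uv(3) by (simp add: coord_hyperplane_def)
    ultimately show ?case ..
  qed
  have kV: "hfold_sum k V \<subseteq> ?H - Y"
  proof
    fix w assume w: "w \<in> hfold_sum k V"
    have "w \<notin> Y"
    proof
      assume "w \<in> Y"
      then have "axis c (of_nat k * ?j) + w \<in> hfold_sum 1 A"
        unfolding a[symmetric] by (simp add: Y_def hfold_sum_1)
      then show False
        using kV_A[OF w] sf unfolding sum_free_def by blast
    qed
    then show "w \<in> ?H - Y"
      using kV_A[OF w] by blast
  qed
  have cHY: "card (?H - Y) = card V"
    using cVY cH YH by (simp add: card_Diff_subset)
  have VkV: "V \<subseteq> hfold_sum k V"
    using k by (intro hfold_sum_contains[OF V0]) simp
  have VHY: "V = ?H - Y"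
    using VkV kV cHY by (intro card_subset_eq) auto
  have "V + V \<subseteq> hfold_sum k V"
  proof -
    obtain k' where k': "k = Suc k'" "1 \<le> k'"
      using k by (cases k) auto
    show ?thesis
      unfolding k' hfold_sum_Suc by (intro set_plus_mono2 hfold_sum_contains[OF V0 k'(2)]) simp
  qed
  then have "V + V \<subseteq> V"
    using kV VHY by blast
  then have sub: "vec.subspace V"
    by (rule subspace_if_closed[OF V0])
  have "a \<in> coords c A"
    unfolding S by (intro image_eqI[of _ _ 0]) auto
  then have "card Y \<noteq> 0"
    using fibre_pos unfolding Y_def card_fibre_hyperplane by fastforce
  then have "V \<noteq> ?H"
    using cVY cH by auto
  then have VH': "V \<subset> ?H"
    using VH by blast
  have HV: "?H - V = Y"
    using VHY YH by blast
  have nz: "(of_nat 1 :: 'p mod_ring) - of_nat k \<noteq> 0"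
    using of_nat_mod_ring_eq_iff[of 1 k, where ?'p = 'p] k by auto
  \<comment> \<open>Solving \<open>a = k (a + m)\<close> for \<open>a\<close> yields the starting
    point in the definition of type 2.\<close>
  have "a * (of_nat 1 - of_nat k) = of_nat (m * k)"
  proof -
    have "a * (of_nat 1 - of_nat k) = a - of_nat k * a"
      by (simp add: right_diff_distrib mult.commute)
    also have "\<dots> = of_nat (m * k)"
      by (subst (1) a) (simp add: algebra_simps)
    finally show ?thesis .
  qed
  then have a_eq: "of_nat (m * k) * inverse (of_nat 1 - of_nat k) = a"
    using nz by (metis eq_divide_imp divide_inverse)
  \<comment> \<open>There are \<open>m - 1\<close> full layers between the ends, so the last index
    is \<open>m - 2\<close>.\<close>
  have mid: "cyc_interval (a + 1) (a + of_nat m - 1) = (\<lambda>i. a + 1 + of_nat i) ` {..m - 2}"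
  proof (rule cyc_interval_conv)
    have "(of_nat m :: 'p mod_ring) = of_nat (m - 2) + 2"
      using k(3) by (simp add: of_nat_diff)
    then show "a + of_nat m - 1 = a + 1 + of_nat (m - 2)"
      by (simp add: algebra_simps)
  qed (use k in simp)
  have ends: "a + of_nat i = a + of_nat j \<longleftrightarrow> i = j" if "i \<le> m" "j \<le> m" for i j
    using of_nat_mod_ring_eq_iff[of i j, where ?'p = 'p] that k(4) by simp
  have "A = coord_prod c {a} (?H - V) \<union> coord_prod c (cyc_interval (a + 1) (a + of_nat m - 1)) ?H
      \<union> coord_prod c {a + of_nat m} V" (is "A = ?B")
  proof (rule Set.set_eqI)
    fix x
    have rest: "x - axis c i \<in> ?H" if "x $ c = i" for i
      using that by (simp add: coord_hyperplane_def)
    have B: "x \<in> ?B \<longleftrightarrow> (x $ c = a \<and> x - axis c a \<in> Y) \<or> x $ c \<in> (\<lambda>i. a + 1 + of_nat i) ` {..m - 2}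
        \<or> (x $ c = ?j \<and> x - axis c ?j \<in> V)"
      using YH VH unfolding HV mid by (simp add: mem_coord_prod_hyperplane mem_coord_prod_singleton)
    show "x \<in> A \<longleftrightarrow> x \<in> ?B"
    proof (cases "x $ c \<in> coords c A")
      case False
      have "x \<notin> A"
        using False by (auto simp: coords_def)
      moreover have "(\<lambda>i. a + 1 + of_nat i) ` {..m - 2} \<subseteq> coords c A"
      proof
        fix s assume "s \<in> (\<lambda>i. a + 1 + of_nat i) ` {..m - 2}"
        then obtain i where "i \<le> m - 2" "s = a + 1 + of_nat i"
          by blast
        then show "s \<in> coords c A"
          unfolding S using k(3) by (intro image_eqI[of _ _ "Suc i"]) auto
      qed
      moreover have "a \<in> coords c A" "?j \<in> coords c A"
        unfolding S by (auto intro!: image_eqI[of _ _ 0])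
      ultimately show ?thesis
        using False B by auto
    next
      case True
      then obtain u where u: "u \<le> m" "x $ c = a + of_nat u"
        unfolding S by blast
      have mid_iff: "x $ c \<in> (\<lambda>i. a + 1 + of_nat i) ` {..m - 2} \<longleftrightarrow> 0 < u \<and> u < m"
      proof
        assume "x $ c \<in> (\<lambda>i. a + 1 + of_nat i) ` {..m - 2}"
        then obtain i where i: "i \<le> m - 2" "a + of_nat u = a + 1 + of_nat i"
          unfolding u(2) by blast
        then have "a + of_nat u = a + of_nat (Suc i)"
          by simp
        then have "u = Suc i"
          using ends[of u "Suc i"] u(1) i(1) k(3) by simp
        then show "0 < u \<and> u < m"
          using i(1) k(3) by simp
      next
        assume "0 < u \<and> u < m"
        then show "x $ c \<in> (\<lambda>i. a + 1 + of_nat i) ` {..m - 2}"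
          using k(3) unfolding u(2) by (intro image_eqI[of _ _ "u - 1"]) (auto simp: of_nat_diff)
      qed
      have a_iff: "x $ c = a \<longleftrightarrow> u = 0" and j_iff: "x $ c = ?j \<longleftrightarrow> u = m"
        using ends[of u 0] ends[of u m] u by auto
      consider "u = 0" | "u = m" "u \<noteq> 0" | "0 < u" "u < m"
        using u(1) by linarith
      then show ?thesis
      proof cases
        case 1
        then show ?thesis
          unfolding B mid_iff a_iff j_iff using k(3) rest a_iff by (auto simp: Y_def)
      next
        case 2
        then show ?thesis
          unfolding B mid_iff a_iff j_iff using k(3) rest j_iff by (auto simp: V_def)
      next
        case 3
        then have "card (fibre c A (x $ c)) = ?N"
          using full[OF True] a_iff j_iff by auto
        then have "x \<in> A"
          using fibre_full by blast
        then show ?thesis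
          unfolding B mid_iff using 3 by blast
      qed
    qed
  qed
  then have "type2 c k 1 m A"
    unfolding type2_def Let_def a_eq using sub VH' n isomorphic_sets_refl[of A] by metis
  then show ?thesis
    unfolding normal_set_def using cardA by blast
qed

text \<open>The equation between the ends is a solution with the right end \<open>k\<close> times
  and the left end \<open>l\<close> times. As the right end is repeated, its fibre is the smaller
  one; the left fibre is more than half full and can be used only once, so
  \<open>l = 1\<close>.\<close>

lemma normal_if_endpoints_meet:
  fixes A :: "('p::prime_card mod_ring ^ 'n::finite) set"
  assumes kl: "l < k" "3 \<le> k" "1 \<le> l" "2 \<le> m" "k < CARD('p)" "m < CARD('p)" "2 < CARD('p)"
    and n: "2 \<le> CARD('n)" and sf: "sum_free k l A"
    and card: "m * CARD('p) ^ (CARD('n) - 1) \<le> card A"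
    and S: "coords c A = (\<lambda>i. a + of_nat i) ` {..m}" "card (coords c A) = m + 1"
    and meet: "of_nat l * a = of_nat k * (a + of_nat m)"
  shows "normal_set c k l m r A"
proof -
  let ?N = "CARD('p) ^ (CARD('n) - 1)" and ?j = "a + of_nat m"
  have mem: "a \<in> coords c A" "?j \<in> coords c A"
    unfolding S(1) by (auto intro!: image_eqI[of _ _ 0])
  have ne: "a \<noteq> ?j"
    using of_nat_mod_ring_eq_iff[of 0 m, where ?'p = 'p] kl by auto
  define z where "z q = (if q < k then ?j else a)" for q
  have two: "card (fibre c A (z q1)) + card (fibre c A (z q2)) \<le> ?N"
    if "q1 \<noteq> q2" "q1 < k + l" "q2 < k + l" for q1 q2
  proof (rule card_two_fibres_le[OF sf _ _ that])
    show "(\<Sum>q<k. z q) = (\<Sum>q<l. z (k + q))"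
      using meet by (simp add: z_def)
  qed (use mem in \<open>simp add: z_def\<close>)
  have "card (fibre c A ?j) + card (fibre c A a) \<le> ?N"
    using two[of 0 k] kl by (simp add: z_def)
  then have eq: "card (fibre c A a) + card (fibre c A ?j) = ?N"
    using card_fibres_pair(1)[OF S(2) card mem ne] by simp
  have "card (fibre c A ?j) + card (fibre c A ?j) \<le> ?N"
    using two[of 0 1] kl by (simp add: z_def)
  moreover have "card (fibre c A a) \<noteq> card (fibre c A ?j)"
  proof
    assume "card (fibre c A a) = card (fibre c A ?j)"
    then have "even ?N"
      unfolding eq[symmetric] by (simp only: even_add)
    then show False
      using odd_card_hyperplane[OF kl(7), of "CARD('n) - 1"] by (rule notE[rotated])
  qed
  ultimately have large: "?N < card (fibre c A a) + card (fibre c A a)"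
    using eq by linarith
  have l: "l = 1"
  proof (rule ccontr)
    assume "l \<noteq> 1"
    then show False
      using two[of k "k + 1"] kl large by (simp add: z_def)
  qed
  have "?j \<noteq> 0"
    using zero_notin_coords[OF _ kl(3,4) sf S(2) card] mem(2) kl(2) by auto
  obtain x0 where x0: "x0 \<in> A" "x0 $ c = ?j"
    using mem(2) unfolding coords_def by auto
  \<comment> \<open>The shear by \<open>w\<close> moves \<open>x0\<close> onto the axis, which puts
    0 into the set \<open>V\<close> of \<open>normal_type2_aux\<close>; the division needs a nonzero
    right end.\<close>
  define w where "w = inverse ?j *s (x0 - axis c ?j)"
  have w: "w $ c = 0"
    using x0(2) by (simp add: w_def)
  define B where "B = (\<lambda>x. x - (x $ c) *s w) ` A"
  have iso: "isomorphic_sets A B"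
    unfolding B_def by (rule isomorphic_sets_shear[OF w])
  have cB: "coords c B = coords c A"
    unfolding B_def by (rule coords_shear[OF w])
  have fB: "card (fibre c B s) = card (fibre c A s)" for s
  proof -
    have "fibre c B s = (\<lambda>x. x - (x $ c) *s w) ` fibre c A s"
      using w by (auto simp: fibre_def B_def)
    moreover have "inj_on (\<lambda>x. x - (x $ c) *s w) (fibre c A s)"
    proof (rule inj_onI)
      fix x y assume "x \<in> fibre c A s" "y \<in> fibre c A s" "x - (x $ c) *s w = y - (y $ c) *s w"
      then have "x - s *s w = y - s *s w"
        by (simp only: fibre_def mem_Collect_eq)
      then show "x = y"
        by simp
    qed
    ultimately show ?thesis
      by (simp add: card_image)
  qed
  have "(x0 $ c) *s w = x0 - axis c ?j"
    unfolding w_def x0(2) vec.scale_scale right_inverse[OF \<open>?j \<noteq> 0\<close>] by (rule vec.scale_one)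
  then have "axis c ?j = x0 - (x0 $ c) *s w"
    by simp
  then have "axis c ?j \<in> B"
    unfolding B_def by (rule image_eqI[OF _ x0(1)])
  moreover have "a = of_nat k * ?j"
    using meet unfolding l by simp
  moreover have "card B = m * ?N"
    using isomorphic_sets_card[OF iso] card_fibres_pair(3)[OF S(2) card mem ne eq] by simp
  moreover have "sum_free k 1 B"
    using isomorphic_sets_sum_free[OF iso sf] unfolding l .
  ultimately have "normal_set c k 1 m r B"
    using kl n S(1) eq card_fibres_pair(2)[OF S(2) card mem ne eq]
    by (intro normal_type2_aux[where a = a]) (simp_all add: cB fB)
  then show ?thesis
    using isomorphic_sets_normal[OF iso] unfolding l by blast
qed

text \<open>The coordinate set is a progression, scaled to an interval. Its k-fold and l-fold sums
  are either disjoint, and the set is trivial, or they touch at one of the two ends.\<close>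

lemma normal_if_many_coords:
  fixes A :: "('p::prime_card mod_ring ^ 'n::finite) set"
  assumes kl: "l < k" "1 \<le> l" "r + 5 \<le> k + l" "7 \<le> m" and p: "CARD('p) = (k + l) * m + 2 + r"
    and n: "2 \<le> CARD('n)" and sf: "sum_free k l A" and nontriv: "\<not> trivial_set c k l m r A"
    and card: "m * CARD('p) ^ (CARD('n) - 1) \<le> card A" and S: "card (coords c A) = m + 1"
  shows "normal_set c k l m r A"
proof -
  have "m \<le> (k + l) * m" "k + l \<le> (k + l) * m"
    using kl by simp_all
  then have kp: "k < CARD('p)" "m < CARD('p)" "2 < CARD('p)"
    using p kl by linarith+
  have k3: "3 \<le> k" "2 \<le> k" "2 \<le> m"
    using kl by linarith+
  have "is_ap (coords c A)"
    using almost_sum_free_is_ap[OF kl p S] card_common_sums_le[OF kl(1) k3(2) kl(2) k3(3) kp(1,3) sf S card]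
    by blast
  then obtain a d where ad: "coords c A = ap a d (Suc m)"
    unfolding is_ap_def S by auto
  have d: "d \<noteq> 0"
    using subset_ap_imp_nonzero[of "coords c A" a d "Suc m"] ad S kl by simp
  define B where "B = (*s) (inverse d) ` A"
  define b where "b = inverse d * a"
  have iso: "isomorphic_sets A B"
    unfolding B_def using d by (intro isomorphic_sets_scale) simp
  have sfB: "sum_free k l B"
    by (rule isomorphic_sets_sum_free[OF iso sf])
  have cardB: "m * CARD('p) ^ (CARD('n) - 1) \<le> card B"
    using card isomorphic_sets_card[OF iso] by simp
  have SB: "coords c B = (\<lambda>i. b + of_nat i) ` {..m}"
    unfolding B_def coords_scale ad scale_ap[OF d] b_def ..
  have inj: "inj_on (\<lambda>i. e + of_nat i) {..m}" for e :: "'p mod_ring"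
    by (rule inj_on_subset[of _ "{..<CARD('p)}"]) (use inj_on_ap[of 1 e] kp in auto)
  have cSB: "card (coords c B) = m + 1"
    unfolding SB card_image[OF inj] by simp
  obtain D where D: "D < CARD('p)" "of_nat l * b - of_nat k * b = of_nat D"
    using surj_of_nat_mod_ring by metis
  then have D': "of_nat l * b = of_nat k * b + of_nat D"
    by (simp add: algebra_simps)
  have "k * m < CARD('p)"
    using p by (simp add: add_mult_distrib)
  then have "(k * m < D \<and> D + l * m < CARD('p)) \<or> D = k * m \<or> D + l * m = CARD('p)"
    using card_common_sums_le[OF kl(1) k3(2) kl(2) k3(3) kp(1,3) sfB cSB cardB] kl unfolding SB
    by (intro interval_almost_sum_free[OF D' D(1)]) auto
  then have "normal_set c k l m r B"
  proof (elim disjE)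
    assume "k * m < D \<and> D + l * m < CARD('p)"
    then have "trivial_set c k l m r B"
      using SB by (intro trivial_if_coords_interval[OF kl(1) kp(1,2) p _ D']) auto
    then show ?thesis
      using nontriv isomorphic_sets_trivial[OF iso] by blast
  next
    assume "D = k * m"
    then have "of_nat l * b = of_nat k * (b + of_nat m)"
      using D' by (simp add: distrib_left)
    then show ?thesis
      using normal_if_endpoints_meet[OF kl(1) k3(1) kl(2) k3(3) kp n sfB cardB SB cSB] by blast
  next
    \<comment> \<open>The upper end of the l-fold sums wraps around to the lower end of the k-fold
      sums; a reflection reduces this to the previous case.\<close>
    assume "D + l * m = CARD('p)"
    then have "(of_nat (D + l * m) :: 'p mod_ring) = 0"
      by simp
    then have Dlm: "(of_nat D :: 'p mod_ring) = - (of_nat l * of_nat m)"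
      by (simp add: eq_neg_iff_add_eq_0)
    define C where "C = (*s) (- 1) ` B"
    have isoC: "isomorphic_sets B C"
      unfolding C_def by (rule isomorphic_sets_scale) simp
    have SC: "coords c C = (\<lambda>i. - (b + of_nat m) + of_nat i) ` {..m}"
      unfolding C_def coords_scale SB by (rule uminus_interval)
    have cSC: "card (coords c C) = m + 1"
      unfolding SC card_image[OF inj] by simp
    have "of_nat l * - (b + of_nat m) = of_nat k * (- (b + of_nat m) + of_nat m)"
      using D' unfolding Dlm by (simp add: algebra_simps)
    then have "normal_set c k l m r C"
      using normal_if_endpoints_meet[OF kl(1) k3(1) kl(2) k3(3) kp n isomorphic_sets_sum_free[OF isoC sfB] _ SC cSC]
        cardB isomorphic_sets_card[OF isoC] by simp
    then show ?thesis
      by (rule isomorphic_sets_normal[OF isoC])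
  qed
  then show ?thesis
    by (rule isomorphic_sets_normal[OF iso])
qed

theorem theorem4p2:
  fixes k l m r :: nat
    and A :: "('p::prime_card mod_ring ^ 'n::finite) set"
    and c :: 'n
  assumes "l < k" and "1 \<le> l"
    and "r + 5 \<le> k + l"
    and "7 \<le> m" and "k + l - 1 \<le> m" and "5 * Tfun (1 / real (k + l)) \<le> of_nat m"
    and "CARD('p) = (k + l) * m + 2 + r"
    and "2 \<le> CARD('n)"
    and "sum_free k l A"
    and "\<not> trivial_set c k l m r A"
    and "m * CARD('p) ^ (CARD('n) - 1) \<le> card A"
    and "\<exists>v K. decomposition v K \<and> omega A v K \<le> m + 1"
  shows "normal_set c k l m r A"
proof -
  let ?N = "CARD('p) ^ (CARD('n) - 1)"
  obtain v K where vK: "decomposition v K" "omega A v K \<le> m + 1"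
    using assms(12) by blast
  obtain B where B: "isomorphic_sets A B" "card (coords c B) = omega A v K"
    using decomposition_isomorphism[OF vK(1)] by blast
  have sfB: "sum_free k l B"
    by (rule isomorphic_sets_sum_free[OF B(1) assms(9)])
  have nontriv: "\<not> trivial_set c k l m r B"
    using assms(10) isomorphic_sets_trivial[OF B(1)] by blast
  have cardB: "m * ?N \<le> card B"
    using assms(11) isomorphic_sets_card[OF B(1)] by simp
  \<comment> \<open>Fibres have at most \<open>p ^ (n - 1)\<close> elements, so at least
    \<open>m\<close> coordinate values occur, and the bound on \<open>omega\<close> leaves only
    \<open>m\<close> and \<open>m + 1\<close>.\<close>
  have "card B \<le> card (coords c B) * ?N"
    using sum_bounded_above[of "coords c B" "\<lambda>i. card (fibre c B i)" ?N] card_fibre_le[of c B]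
    unfolding card_eq_sum_fibres[of B c] by simp
  then have "m * ?N \<le> card (coords c B) * ?N"
    using cardB by (rule order_trans[rotated])
  then have "m \<le> card (coords c B)"
    by simp
  then consider "card (coords c B) = m" | "card (coords c B) = m + 1"
    using B(2) vK(2) by linarith
  then have "normal_set c k l m r B"
  proof cases
    case 1
    then show ?thesis
      by (rule normal_if_few_coords[OF assms(1-7) sfB nontriv cardB])
  next
    case 2
    then show ?thesis
      by (rule normal_if_many_coords[OF assms(1-4,7,8) sfB nontriv cardB])
  qed
  then show ?thesis
    by (rule isomorphic_sets_normal[OF B(1)])
qed

end
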